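(* Let $D\ge 1$ be an integer, let $v_1,\dots,v_D>0$, let $e_1,\dots,e_D$ be the standard basis of $\mathbb{R}^D$, and let $\mathcal{L}\subset\{\sum_{d=1}^D k_d v_d e_d : k_d\in\mathbb{Z}\}$. Let $\{Z(s), s\in\mathcal{L}\}$ be a real-valued stationary Gaussian random field such that the spatial correlation between $s$ and $t$ is $$\rho(s,t)=\exp\left[-\tfrac12 (s-t)^\top\Lambda(s-t)\right],\qquad \Lambda=\operatorname{diag}\left(\tfrac{1}{2\eta_1^2},\dots,\tfrac{1}{2\eta_D^2}\right),$$ for some $\eta_1,\dots,\eta_D>0$. Let $s\in\mathcal{L}$ be such that $\mathcal{N}_{PC}(s)\subseteq\mathcal{L}$, where $\mathcal{N}_{PC}(s)=\{s+k v_d e_d : k\in\{-1,1\},\ 1\le d\le D\}$ is the partially connected neighbourhood of $s$. For $1\le d\le D$ put $\rho_d=\rho(s,s+v_de_d)$. Then for all $u\in\mathbb{R}$, $$P\left[Z(s)>u \mid Z(t)<Z(s),\ \forall t\in\mathcal{N}_{PC}(s)\right]=\frac{\int_u^\infty\left(\prod_{d=1}^D Q(\rho_d,z)\right)\phi(z)\,dz}{\int_{-\infty}^\infty\left(\prod_{d=1}^D Q(\rho_d,z)\right)\phi(z)\,dz},$$ where $$Q(\rho_d,z)=1-2\Phi(h_d z^+)+\frac1\pi\int_0^{\alpha_d}\exp\left(-\tfrac12 h_d^2z^2/\sin^2\theta\right)d\theta,$$ $$h_d=\sqrt{\frac{1-\rho_d}{1+\rho_d}},\qquad \alpha_d=\sin^{-1}\left(\sqrt{(1-\rho_d^2)/2}\right),\qquad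 z^+=\max(z,0).$$ In particular, the density $f_{\mathrm{DLM}}$ of the peak height distribution (the conditional distribution of $Z(s)$ given that $Z(t)<Z(s)$ for all $t\in\mathcal{N}_{PC}(s)$) is $$f_{\mathrm{DLM}}(z)=\frac{\left(\prod_{d=1}^D Q(\rho_d,z)\right)\phi(z)}{\int_{-\infty}^\infty\left(\prod_{d=1}^D Q(\rho_d,z)\right)\phi(z)\,dz}.$$
   Context: A Gaussian random field on $\mathcal{L}$ is a family of real random variables indexed by $\mathcal{L}$ all of whose finite-dimensional marginals are multivariate Gaussian; stationary means that the mean is constant and the covariance of $Z(s)$ and $Z(t)$ depends only on $s-t$. Here $\phi$ is the standard normal density and $\Phi$ is the standard normal cumulative distribution function. The points of $\mathcal{L}$ are lattice sites with step size $v_d$ in direction $d$, and $\eta_d$ is the standard deviation, in direction $d$, of the Gaussian kernel giving rise to the correlation function.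
   Formalization: In Q, the distribution function Φ(h_d z⁺) is replaced by the upper tail 1 − Φ(h_d z⁺), since the printed Q becomes negative for large z; and Z is assumed to have mean 0 and variance 1, without which the formula fails. *)

theory Defs
  imports "HOL-Probability.Probability"
begin

(* A constant is admitted as the degenerate case of variance 0. *)
definition gaussian_rv :: "'w measure \<Rightarrow> ('w \<Rightarrow> real) \<Rightarrow> bool" where
  "gaussian_rv M X \<longleftrightarrow> X \<in> borel_measurable M \<and>
     ((\<exists>\<mu> \<sigma>. 0 < \<sigma> \<and> distributed M lborel X (\<lambda>x. ennreal (normal_density \<mu> \<sigma> x))) \<or>
      (\<exists>c. AE \<omega> in M. X \<omega> = c))"

definition multivariate_gaussian :: "'w measure \<Rightarrow> 'i set \<Rightarrow> ('i \<Rightarrow> 'w \<Rightarrow> real) \<Rightarrow> bool" where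
  "multivariate_gaussian M I X \<longleftrightarrow>
     (\<forall>a :: 'i \<Rightarrow> real. gaussian_rv M (\<lambda>\<omega>. \<Sum>i\<in>I. a i * X i \<omega>))"

definition gaussian_field :: "'w measure \<Rightarrow> 'i set \<Rightarrow> ('i \<Rightarrow> 'w \<Rightarrow> real) \<Rightarrow> bool" where
  "gaussian_field M L Z \<longleftrightarrow> prob_space M \<and>
     (\<forall>I. finite I \<and> I \<subseteq> L \<longrightarrow> multivariate_gaussian M I Z)"

definition expect :: "'w measure \<Rightarrow> ('w \<Rightarrow> real) \<Rightarrow> real" where
  "expect M X = (LINT \<omega>|M. X \<omega>)"

definition covariance :: "'w measure \<Rightarrow> ('w \<Rightarrow> real) \<Rightarrow> ('w \<Rightarrow> real) \<Rightarrow> real" where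
  "covariance M X Y = expect M (\<lambda>\<omega>. (X \<omega> - expect M X) * (Y \<omega> - expect M Y))"

definition correlation :: "'w measure \<Rightarrow> ('w \<Rightarrow> real) \<Rightarrow> ('w \<Rightarrow> real) \<Rightarrow> real" where
  "correlation M X Y = covariance M X Y / (sqrt (covariance M X X) * sqrt (covariance M Y Y))"

definition stationary_gaussian_field ::
  "'w measure \<Rightarrow> ('i::ab_group_add) set \<Rightarrow> ('i \<Rightarrow> 'w \<Rightarrow> real) \<Rightarrow> bool" where
  "stationary_gaussian_field M L Z \<longleftrightarrow> gaussian_field M L Z \<and>
     (\<exists>m. \<forall>s\<in>L. expect M (Z s) = m) \<and>
     (\<exists>C. \<forall>s\<in>L. \<forall>t\<in>L. covariance M (Z s) (Z t) = C (s - t))"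

definition lattice_sites :: "real^'d \<Rightarrow> (real^'d) set" where
  "lattice_sites v = {\<Sum>d\<in>UNIV. (of_int (k d) * v $ d) *\<^sub>R axis d 1 | k :: 'd \<Rightarrow> int. True}"

definition N_PC :: "real^'d \<Rightarrow> real^'d \<Rightarrow> (real^'d) set" where
  "N_PC v s = {s + (k * v $ d) *\<^sub>R axis d 1 | k d. k \<in> {-1, 1}}"

definition Lambda :: "real^'d \<Rightarrow> real^'d^'d" where
  "Lambda \<eta> = (\<chi> i j. if i = j then 1 / (2 * (\<eta> $ i)\<^sup>2) else 0)"

definition spatial_corr :: "real^'d \<Rightarrow> real^'d \<Rightarrow> real^'d \<Rightarrow> real" where
  "spatial_corr \<eta> s t = exp (- (1/2) * ((s - t) \<bullet> (Lambda \<eta> *v (s - t))))"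

definition rho_dir :: "real^'d \<Rightarrow> real^'d \<Rightarrow> real^'d \<Rightarrow> 'd \<Rightarrow> real" where
  "rho_dir v \<eta> s d = spatial_corr \<eta> s (s + (v $ d) *\<^sub>R axis d 1)"

definition std_normal_cdf :: "real \<Rightarrow> real" where
  "std_normal_cdf x = cdf std_normal_distribution x"

definition h_coef :: "real \<Rightarrow> real" where
  "h_coef r = sqrt ((1 - r) / (1 + r))"

definition alpha_coef :: "real \<Rightarrow> real" where
  "alpha_coef r = arcsin (sqrt ((1 - r\<^sup>2) / 2))"

(* The term 1 - 2 \<Phi>(h z+) in the usual way of writing Q is correct only when \<Phi> stands for the upper
   tail of the standard normal law; with the distribution function in that place Q would tend to
   -1 as z tends to infinity, whereas Q r z has to be the conditional probability that both
   neighbours in one direction lie below z, given the value z at the centre.  Hence the upper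
   tail is written out as 1 - std_normal_cdf.  In the integrand, the value 1/0 = 0 at
   theta = 0 concerns a null set only. *)
definition Q :: "real \<Rightarrow> real \<Rightarrow> real" where
  "Q r z = 1 - 2 * (1 - std_normal_cdf (h_coef r * max z 0))
     + 1 / pi * (LBINT \<theta>:{0..alpha_coef r}. exp (- (1/2) * (h_coef r)\<^sup>2 * z\<^sup>2 / (sin \<theta>)\<^sup>2))"

end

theory Submission
  imports Defs
begin

text \<open>Given the central value z, neighbours in different directions are uncorrelated, hence
  independent, so the conditional probability of a peak is a product over directions.  In one
  direction with correlation \<open>\<rho>\<close>, the standardised residuals of the two neighbours have correlation
  \<open>- \<rho>\<^sup>2\<close>, hence are \<open>sin \<alpha> * U + cos \<alpha> * V\<close> and \<open>sin \<alpha> * U - cos \<alpha> * V\<close> with independent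
  standard normal U and V, and both neighbours lie below z iff both residuals lie below \<open>h * z\<close>.
  By inclusion-exclusion this event has a probability given by the normal distribution function and
  the mass of the wedge \<open>sin \<alpha> * u - cos \<alpha> * \<bar>v\<bar> \<ge> b\<close>, which is computed in polar
  coordinates.  Independence of uncorrelated jointly Gaussian variables, defined through linear
  combinations, follows from the uniqueness theorem for characteristic functions on the line, applied
  to one coordinate at a time.\<close>

section \<open>Joint characteristic functions and independence\<close>

text \<open>The constants come from the kernel. Opposite neighbours are 2 v_d apart and have
  correlation \<rho>^4; neighbours in directions d and e have correlation \<rho>_d \<rho>_e.
  Subtracting \<rho> times the centre leaves variance 1 - \<rho>^2 for each neighbour, covariance
  \<rho>^4 - \<rho>^2 for an opposite pair and covariance 0 across directions. Hence the correlation
  -\<rho>^2 = (sin \<alpha>)^2 - (cos \<alpha>)^2, and the threshold (z - \<rho> z) / sqrt (1 -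
  \<rho>^2) = h z. The event that the centre equals z is null, so no conditional law given z is
  formed: centre and residuals are replaced by independent variables, and Fubini fixes z. The
  positive part in \<open>Q\<close> reflects two regimes. For a threshold b \<ge> 0 the wedge is the
  complement of a union and inclusion-exclusion brings in the normal distribution function; for b <
  0 the event is a reflected wedge itself, and the normal term must be 0, which it is since
  \<open>std_normal_cdf 0\<close> is 1/2.\<close>

text \<open>Normalising the weight makes it a probability density. Under the tilted measure the
  characteristic function of \<open>X\<close> is that of \<open>\<mu>\<close>, so Levy uniqueness
  identifies the tilted law. The weight will be a function of a second variable, which thereby turns
  out to carry no information about \<open>X\<close>.\<close>

lemma (in prob_space) weighted_law_eqI:
  fixes X w :: "'a \<Rightarrow> real"
  assumes [measurable]: "X \<in> borel_measurable M" "w \<in> borel_measurable M"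
    and w: "\<And>\<omega>. 0 \<le> w \<omega>" "\<And>\<omega>. w \<omega> \<le> B"
    and pos: "0 < expectation w"
    and \<mu>: "real_distribution \<mu>"
    and cf: "\<And>t. (CLINT \<omega>|M. w \<omega> *\<^sub>R iexp (t * X \<omega>)) = expectation w *\<^sub>R char \<mu> t"
    and A[measurable]: "A \<in> sets borel"
  shows "expectation (\<lambda>\<omega>. w \<omega> * indicator A (X \<omega>)) = expectation w * measure \<mu> A"
proof -
  define c where "c = expectation w"
  have c: "c > 0" using pos by (simp add: c_def)
  have int_w: "integrable M w"
    by (rule integrable_const_bound[of _ B]) (use w in auto)
  define N where "N = density M (\<lambda>\<omega>. ennreal (w \<omega> / c))"
  have "emeasure N (space N) = ennreal (expectation (\<lambda>\<omega>. w \<omega> / c))"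
    using int_w w c unfolding N_def
    by (subst emeasure_density) (auto simp: nn_integral_eq_integral cong: nn_integral_cong)
  also have "\<dots> = 1"
    using c by (simp add: c_def)
  finally interpret N: prob_space N by (rule prob_spaceI)
  have [measurable]: "X \<in> borel_measurable N" by (simp add: N_def)
  define D where "D = distr N borel X"
  interpret D: real_distribution D
    unfolding D_def by (intro N.real_distribution_distr) simp
  have "char D = char \<mu>"
  proof
    fix t
    have "char D t = (CLINT \<omega>|N. iexp (t * X \<omega>))"
      unfolding char_def D_def by (subst integral_distr) auto
    also have "\<dots> = (CLINT \<omega>|M. (w \<omega> / c) *\<^sub>R iexp (t * X \<omega>))"
      unfolding N_def by (subst integral_density) (use w c in auto)
    also have "\<dots> = (CLINT \<omega>|M. (1/c) *\<^sub>R (w \<omega> *\<^sub>R iexp (t * X \<omega>)))"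
      by (intro Bochner_Integration.integral_cong refl) (simp add: field_simps)
    also have "\<dots> = (1 / c) *\<^sub>R (CLINT \<omega>|M. w \<omega> *\<^sub>R iexp (t * X \<omega>))"
      by (rule integral_scaleR_right)
    also have "\<dots> = char \<mu> t"
      using cf[of t] c by (simp add: c_def)
    finally show "char D t = char \<mu> t" .
  qed
  then have "D = \<mu>" by (intro Levy_uniqueness \<mu> D.real_distribution_axioms)
  then have "measure \<mu> A = (LINT x|D. indicator A x)" using D.space_eq_univ by simp
  also have "\<dots> = (LINT \<omega>|N. indicator A (X \<omega>))"
    unfolding D_def by (subst integral_distr) auto
  also have "\<dots> = expectation (\<lambda>\<omega>. (w \<omega> / c) *\<^sub>R indicator A (X \<omega>))"
    unfolding N_def by (subst integral_density) (use w c in auto)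
  also have "\<dots> = expectation (\<lambda>\<omega>. (1 / c) * (w \<omega> * indicator A (X \<omega>)))"
    by (intro Bochner_Integration.integral_cong refl) simp
  also have "\<dots> = (1 / c) * expectation (\<lambda>\<omega>. w \<omega> * indicator A (X \<omega>))"
    by (rule integral_mult_right_zero)
  finally show ?thesis using c by (simp add: c_def)
qed

text \<open>The weights 2 + cos (Y + \<beta>) are positive and have a mean that is a linear combination of values
  of the characteristic function, so that each of them reduces to the uniqueness theorem on the line.\<close>

lemma (in prob_space) cis_expectation_factor:
  fixes X Y :: "'a \<Rightarrow> real"
  assumes [measurable]: "X \<in> borel_measurable M" "Y \<in> borel_measurable M" "A \<in> sets borel"
    and \<mu>: "real_distribution \<mu>"
    and cf1: "\<And>t. (CLINT \<omega>|M. iexp (t * X \<omega> + Y \<omega>)) = char \<mu> t * (CLINT \<omega>|M. iexp (Y \<omega>))"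
    and cf2: "\<And>t. (CLINT \<omega>|M. iexp (t * X \<omega> - Y \<omega>)) = char \<mu> t * (CLINT \<omega>|M. iexp (- Y \<omega>))"
    and cf3: "\<And>t. (CLINT \<omega>|M. iexp (t * X \<omega>)) = char \<mu> t"
  shows "(CLINT \<omega>|M. indicator A (X \<omega>) *\<^sub>R iexp (Y \<omega>)) = measure \<mu> A *\<^sub>R (CLINT \<omega>|M. iexp (Y \<omega>))"
    and "expectation (\<lambda>\<omega>. indicator A (X \<omega>)) = measure \<mu> A"
proof -
  have iX: "integrable M (\<lambda>\<omega>. iexp (f \<omega>))" if "f \<in> borel_measurable M" for f :: "'a \<Rightarrow> real"
    using that by (intro integrable_const_bound[of _ 1]) (auto simp: norm_exp_i_times)
  show one: "expectation (\<lambda>\<omega>. indicator A (X \<omega>)) = measure \<mu> A"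
    using weighted_law_eqI[of X "\<lambda>_. 1" 1 \<mu> A] cf3 \<mu> by (simp add: prob_space)
  \<comment> \<open>The phase \<beta> is kept free because the real and the imaginary part of the
    exponential are both cosines with a shifted argument.\<close>
  have key: "expectation (\<lambda>\<omega>. indicator A (X \<omega>) * cos (Y \<omega> + \<beta>)) = measure \<mu> A * expectation (\<lambda>\<omega>. cos (Y \<omega> + \<beta>))" for \<beta>
  proof -
    define w where "w = (\<lambda>\<omega>. 2 + cos (Y \<omega> + \<beta>))"
    have [measurable]: "w \<in> borel_measurable M" by (simp add: w_def)
    have w: "1 \<le> w \<omega>" "w \<omega> \<le> 3" for \<omega>
      unfolding w_def using cos_ge_minus_one[of "Y \<omega> + \<beta>"] cos_le_one[of "Y \<omega> + \<beta>"] by linarith+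
    have w0: "0 \<le> w \<omega>" for \<omega> using w[of \<omega>] by simp
    have int_w: "integrable M w" by (rule integrable_const_bound[of _ 3]) (use w w0 in auto)
    have pos: "0 < expectation w"
      using integral_ge_const[OF int_w, of 1] w by (simp add: order_less_le_trans[of 0 1])
    have wexp: "complex_of_real (w \<omega>) = 2 + (iexp \<beta> / 2) * iexp (Y \<omega>) + (iexp (-\<beta>) / 2) * iexp (- Y \<omega>)" for \<omega>
      unfolding w_def by (simp add: cos_exp_eq cos_of_real[symmetric] exp_add[symmetric] algebra_simps add_divide_distrib)
    have cfw: "(CLINT \<omega>|M. w \<omega> *\<^sub>R iexp (t * X \<omega>)) = 2 * char \<mu> t + (iexp \<beta> / 2) * (char \<mu> t * (CLINT \<omega>|M. iexp (Y \<omega>)))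
       + (iexp (-\<beta>) / 2) * (char \<mu> t * (CLINT \<omega>|M. iexp (- Y \<omega>)))" for t
    proof -
      have "(CLINT \<omega>|M. w \<omega> *\<^sub>R iexp (t * X \<omega>)) = (CLINT \<omega>|M. 2 * iexp (t * X \<omega>)
         + (iexp \<beta> / 2) * iexp (t * X \<omega> + Y \<omega>) + (iexp (-\<beta>) / 2) * iexp (t * X \<omega> - Y \<omega>))"
        by (intro Bochner_Integration.integral_cong refl)
           (simp add: scaleR_conv_of_real wexp exp_add[symmetric] exp_diff algebra_simps exp_minus divide_simps)
      also have "\<dots> = 2 * (CLINT \<omega>|M. iexp (t * X \<omega>)) + (iexp \<beta> / 2) * (CLINT \<omega>|M. iexp (t * X \<omega> + Y \<omega>))
           + (iexp (-\<beta>) / 2) * (CLINT \<omega>|M. iexp (t * X \<omega> - Y \<omega>))"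
      proof -
        have "integrable M (\<lambda>\<omega>. iexp (t * X \<omega>))" "integrable M (\<lambda>\<omega>. iexp (t * X \<omega> + Y \<omega>))" "integrable M (\<lambda>\<omega>. iexp (t * X \<omega> - Y \<omega>))"
          by (intro iX; measurable)+
        then show ?thesis
          by (simp del: of_real_add of_real_diff of_real_mult of_real_minus)
      qed
      finally show ?thesis unfolding cf1 cf2 cf3 .
    qed
    \<comment> \<open>Evaluating \<open>cfw\<close> at t = 0 identifies the mean of
      \<open>w\<close>, which is the factor that has to come out in front of
      \<open>char \<mu> t\<close>.\<close>
    have "complex_of_real (expectation w) = (CLINT \<omega>|M. w \<omega> *\<^sub>R iexp (0 * X \<omega>))"
      using int_w by (simp add: scaleR_conv_of_real)
    also have "\<dots> = 2 * char \<mu> 0 + (iexp \<beta> / 2) * (char \<mu> 0 * (CLINT \<omega>|M. iexp (Y \<omega>)))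
       + (iexp (-\<beta>) / 2) * (char \<mu> 0 * (CLINT \<omega>|M. iexp (- Y \<omega>)))"
      by (rule cfw)
    finally have Ew: "complex_of_real (expectation w) = 2 + (iexp \<beta> / 2) * (CLINT \<omega>|M. iexp (Y \<omega>))
       + (iexp (-\<beta>) / 2) * (CLINT \<omega>|M. iexp (- Y \<omega>))"
      using real_distribution.char_zero[OF \<mu>] by simp
    have "(CLINT \<omega>|M. w \<omega> *\<^sub>R iexp (t * X \<omega>)) = expectation w *\<^sub>R char \<mu> t" for t
      unfolding cfw unfolding scaleR_conv_of_real Ew by (simp add: algebra_simps)
    with weighted_law_eqI[of X w 3 \<mu> A] w w0 pos \<mu>
    have "expectation (\<lambda>\<omega>. w \<omega> * indicator A (X \<omega>)) = expectation w * measure \<mu> A" by simp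
    moreover have "expectation w = 2 + expectation (\<lambda>\<omega>. cos (Y \<omega> + \<beta>))"
      unfolding w_def
      by (subst Bochner_Integration.integral_add) (auto intro!: integrable_const_bound[of _ 1] simp: prob_space)
    moreover have "expectation (\<lambda>\<omega>. w \<omega> * indicator A (X \<omega>)) =
        2 * expectation (\<lambda>\<omega>. indicator A (X \<omega>)) + expectation (\<lambda>\<omega>. indicator A (X \<omega>) * cos (Y \<omega> + \<beta>))"
    proof -
      have i1: "integrable M (\<lambda>\<omega>. indicator A (X \<omega>) :: real)"
        by (intro integrable_const_bound[of _ 1]) (auto simp: indicator_def)
      have i2: "integrable M (\<lambda>\<omega>. indicator A (X \<omega>) * cos (Y \<omega> + \<beta>) :: real)"
        by (intro integrable_const_bound[of _ 1]) (auto simp: indicator_def)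
      have "expectation (\<lambda>\<omega>. w \<omega> * indicator A (X \<omega>)) = expectation (\<lambda>\<omega>. 2 * indicator A (X \<omega>) + indicator A (X \<omega>) * cos (Y \<omega> + \<beta>))"
        by (intro Bochner_Integration.integral_cong refl) (simp add: w_def algebra_simps)
      then show ?thesis using i1 i2 by simp
    qed
    \<comment> \<open>The constant 2 in the weight contributes 2 times \<open>one\<close> to both
      sides and cancels, which leaves the cosine alone.\<close>
    ultimately show ?thesis using one by (simp add: algebra_simps)
  qed
  have Re: "Re (iexp y) = cos (y + 0)" and Im: "Im (iexp y) = cos (y + - (pi/2))" for y :: real
    by (simp_all add: Re_exp Im_exp cos_diff)
  have i2: "integrable M (\<lambda>\<omega>. indicator A (X \<omega>) *\<^sub>R iexp (Y \<omega>))"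
    by (intro integrable_const_bound[of _ 1]) (auto simp: indicator_def norm_exp_i_times)
  have i3: "integrable M (\<lambda>\<omega>. iexp (Y \<omega>))" by (intro iX) measurable
  show "(CLINT \<omega>|M. indicator A (X \<omega>) *\<^sub>R iexp (Y \<omega>)) = measure \<mu> A *\<^sub>R (CLINT \<omega>|M. iexp (Y \<omega>))"
    apply (rule complex_eqI)
    subgoal using key[of 0] unfolding integral_Re[OF i2, symmetric] integral_Re[OF i3, symmetric] Re scaleR_complex.sel .
    subgoal using key[of "-(pi/2)"] unfolding integral_Im[OF i2, symmetric] integral_Im[OF i3, symmetric] Im scaleR_complex.sel .
    done
qed

text \<open>Conditioning on the event for one variable changes the underlying measure but not the
  joint characteristic function of the remaining ones. The induction therefore runs over all
  probability measures \<open>M\<close> at once.\<close>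

lemma prob_product_of_char_product:
  fixes X :: "'i \<Rightarrow> 'a \<Rightarrow> real"
  assumes "finite I" "prob_space M"
    and "\<And>i. i \<in> I \<Longrightarrow> X i \<in> borel_measurable M"
    and "\<And>i. i \<in> I \<Longrightarrow> real_distribution (\<mu> i)"
    and "\<And>a. (CLINT \<omega>|M. iexp (\<Sum>i\<in>I. a i * X i \<omega>)) = (\<Prod>i\<in>I. char (\<mu> i) (a i))"
    and "\<And>i. i \<in> I \<Longrightarrow> A i \<in> sets borel"
  shows "measure M {\<omega>\<in>space M. \<forall>i\<in>I. X i \<omega> \<in> A i} = (\<Prod>i\<in>I. measure (\<mu> i) (A i))"
  using assms
proof (induction I arbitrary: M)
  case empty
  then interpret prob_space M by simp
  show ?case by (simp add: prob_space)
next
  case (insert j I M)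
  interpret prob_space M by fact
  have [measurable]: "X j \<in> borel_measurable M" "A j \<in> sets borel" and \<mu>j: "real_distribution (\<mu> j)"
    using insert.prems by auto
  have XI[measurable]: "\<And>i. i \<in> I \<Longrightarrow> X i \<in> borel_measurable M" and AI[measurable]: "\<And>i. i \<in> I \<Longrightarrow> A i \<in> sets borel"
    using insert.prems by auto
  have [simp]: "char (\<mu> j) 0 = 1" using real_distribution.char_zero[OF \<mu>j] .
  have upd: "(\<Sum>i\<in>I. (a(j := t)) i * X i \<omega>) = (\<Sum>i\<in>I. a i * X i \<omega>)"
    "(\<Prod>i\<in>I. char (\<mu> i) ((a(j := t)) i)) = (\<Prod>i\<in>I. char (\<mu> i) (a i))" for a t \<omega>
    using insert.hyps by (auto intro!: sum.cong prod.cong)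
  have cf: "(CLINT \<omega>|M. iexp (t * X j \<omega> + (\<Sum>i\<in>I. a i * X i \<omega>))) = char (\<mu> j) t * (\<Prod>i\<in>I. char (\<mu> i) (a i))" for a t
    using insert.prems(4)[of "a(j := t)"] insert.hyps
    by (simp only: sum.insert prod.insert upd fun_upd_same not_False_eq_True)
  have cf0: "(CLINT \<omega>|M. iexp (\<Sum>i\<in>I. a i * X i \<omega>)) = (\<Prod>i\<in>I. char (\<mu> i) (a i))" for a
    using cf[of 0 a] by simp
  \<comment> \<open>Zero coefficients switch variables off, so the hypothesis on all linear
    combinations also yields the law of \<open>X j\<close> alone.\<close>
  have zero: "(\<Prod>i\<in>I. char (\<mu> i) 0) = 1"
    using insert.prems by (intro prod.neutral) (auto intro!: real_distribution.char_zero)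
  have fac: "(CLINT \<omega>|M. indicator (A j) (X j \<omega>) *\<^sub>R iexp (\<Sum>i\<in>I. a i * X i \<omega>)) = measure (\<mu> j) (A j) *\<^sub>R (\<Prod>i\<in>I. char (\<mu> i) (a i))"
    and EA: "expectation (\<lambda>\<omega>. indicator (A j) (X j \<omega>)) = measure (\<mu> j) (A j)" for a
  proof -
    have neg: "(\<Sum>i\<in>I. (- a i) * X i \<omega>) = - (\<Sum>i\<in>I. a i * X i \<omega>)" for \<omega>
      by (simp add: sum_negf)
    have mY: "(\<lambda>\<omega>. \<Sum>i\<in>I. a i * X i \<omega>) \<in> borel_measurable M" by measurable
    have 1: "(CLINT \<omega>|M. iexp (t * X j \<omega> + (\<Sum>i\<in>I. a i * X i \<omega>))) = char (\<mu> j) t * (CLINT \<omega>|M. iexp (\<Sum>i\<in>I. a i * X i \<omega>))" for t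
      unfolding cf0 cf ..
    have 2: "(CLINT \<omega>|M. iexp (t * X j \<omega> - (\<Sum>i\<in>I. a i * X i \<omega>))) = char (\<mu> j) t * (CLINT \<omega>|M. iexp (- (\<Sum>i\<in>I. a i * X i \<omega>)))" for t
      using cf[of t "\<lambda>i. - a i"] cf0[of "\<lambda>i. - a i"] unfolding neg by simp
    have 3: "(CLINT \<omega>|M. iexp (t * X j \<omega>)) = char (\<mu> j) t" for t
      using cf[of t "\<lambda>_. 0"] zero by simp
    from cis_expectation_factor[OF _ mY _ \<mu>j 1 2 3, of "A j"]
    show "(CLINT \<omega>|M. indicator (A j) (X j \<omega>) *\<^sub>R iexp (\<Sum>i\<in>I. a i * X i \<omega>)) = measure (\<mu> j) (A j) *\<^sub>R (\<Prod>i\<in>I. char (\<mu> i) (a i))"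
      and "expectation (\<lambda>\<omega>. indicator (A j) (X j \<omega>)) = measure (\<mu> j) (A j)"
      unfolding cf0 by simp_all
  qed
  define S where "S = {\<omega>\<in>space M. X j \<omega> \<in> A j}"
  have S[measurable]: "S \<in> events" unfolding S_def by measurable
  have "prob S = expectation (indicator S)" by simp
  also have "\<dots> = expectation (\<lambda>\<omega>. indicator (A j) (X j \<omega>))"
    by (intro Bochner_Integration.integral_cong refl) (auto simp: S_def indicator_def)
  finally have pS: "prob S = measure (\<mu> j) (A j)" using EA by simp
  define T where "T = {\<omega>\<in>space M. \<forall>i\<in>I. X i \<omega> \<in> A i}"
  have T[measurable]: "T \<in> events" unfolding T_def using \<open>finite I\<close> by measurable
  have split: "{\<omega>\<in>space M. \<forall>i\<in>insert j I. X i \<omega> \<in> A i} = S \<inter> T"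
    by (auto simp: S_def T_def)
  show ?case
  \<comment> \<open>A null event cannot be conditioned on, but then both sides of the claim are
    0.\<close>
  proof (cases "prob S = 0")
    case True
    have "prob (S \<inter> T) \<le> prob S" by (intro finite_measure_mono) auto
    with True have "prob (S \<inter> T) = 0" using measure_nonneg[of M "S \<inter> T"] by linarith
    then show ?thesis unfolding split using insert.hyps pS True by simp
  next
    case False
    \<comment> \<open>Conditioning on the event for \<open>X j\<close> leaves the joint characteristic function of the others unchanged.\<close>
    define N where "N = uniform_measure M S"
    have eS: "emeasure M S \<noteq> 0" "emeasure M S \<noteq> \<infinity>" using False by (auto simp: emeasure_eq_measure)
    have ps: "prob_space N" unfolding N_def by (rule prob_space_uniform_measure[OF eS])
    have Nd: "N = density M (\<lambda>\<omega>. ennreal (indicator S \<omega> / prob S))"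
      unfolding N_def uniform_measure_def using False
      by (intro density_cong)
         (auto simp: emeasure_eq_measure indicator_def zero_less_measure_iff divide_ennreal[of 1, simplified])
    have "(CLINT \<omega>|N. iexp (\<Sum>i\<in>I. a i * X i \<omega>)) = (\<Prod>i\<in>I. char (\<mu> i) (a i))" for a
    proof -
      have "(CLINT \<omega>|N. iexp (\<Sum>i\<in>I. a i * X i \<omega>)) = (CLINT \<omega>|M. (indicator S \<omega> / prob S) *\<^sub>R iexp (\<Sum>i\<in>I. a i * X i \<omega>))"
        unfolding Nd by (subst integral_density) auto
      also have "\<dots> = (CLINT \<omega>|M. (1 / prob S) *\<^sub>R (indicator (A j) (X j \<omega>) *\<^sub>R iexp (\<Sum>i\<in>I. a i * X i \<omega>)))"
        by (intro Bochner_Integration.integral_cong refl) (auto simp: S_def indicator_def)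
      also have "\<dots> = (1 / prob S) *\<^sub>R (CLINT \<omega>|M. indicator (A j) (X j \<omega>) *\<^sub>R iexp (\<Sum>i\<in>I. a i * X i \<omega>))"
        by (rule integral_scaleR_right)
      also have "\<dots> = (\<Prod>i\<in>I. char (\<mu> i) (a i))"
        unfolding fac using False pS by simp
      finally show ?thesis .
    qed
    then have "measure N {\<omega>\<in>space N. \<forall>i\<in>I. X i \<omega> \<in> A i} = (\<Prod>i\<in>I. measure (\<mu> i) (A i))"
      by (intro insert.IH ps) (use insert.prems in \<open>auto simp: N_def\<close>)
    moreover have "measure N {\<omega>\<in>space N. \<forall>i\<in>I. X i \<omega> \<in> A i} = prob (S \<inter> T) / prob S"
      unfolding N_def space_uniform_measure T_def[symmetric] using eS T by (rule measure_uniform_measure)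
    ultimately show ?thesis unfolding split using False insert.hyps pS by (simp add: field_simps)
  qed
qed

section \<open>Gaussian linear combinations: from second moments to independence\<close>

text \<open>The definition speaks of sums over sets of sites, later sums run over an index. As
  \<open>g\<close> may repeat a site, the coefficients that share a site are added up first.\<close>

lemma gaussian_field_sum:
  fixes g :: "'k \<Rightarrow> 'i"
  assumes "gaussian_field M L Z" "finite K" "g ` K \<subseteq> L"
  shows "gaussian_rv M (\<lambda>\<omega>. \<Sum>k\<in>K. c k * Z (g k) \<omega>)"
proof -
  have "(\<Sum>k\<in>K. c k * Z (g k) \<omega>) = (\<Sum>t\<in>g ` K. (\<Sum>k | k \<in> K \<and> g k = t. c k) * Z t \<omega>)" for \<omega>
    by (subst sum.image_gen[OF assms(2), of _ g]) (simp add: sum_distrib_right)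
  then show ?thesis
    using assms by (simp add: gaussian_field_def multivariate_gaussian_def)
qed

text \<open>One formula covers both cases of \<open>gaussian_rv\<close>: a constant with mean 0
  vanishes almost surely, so its second moment is 0 and the exponential is 1. Degenerate linear
  combinations thus need no separate treatment later.\<close>

lemma (in prob_space) gaussian_rv_char:
  assumes g: "gaussian_rv M Y" and mean: "expectation Y = 0"
  shows "(CLINT \<omega>|M. iexp (Y \<omega>)) = exp (- expectation (\<lambda>\<omega>. (Y \<omega>)\<^sup>2) / 2)"
proof -
  have [measurable]: "Y \<in> borel_measurable M" using g by (simp add: gaussian_rv_def)
  from g consider \<mu> \<sigma> where "0 < \<sigma>" "distributed M lborel Y (normal_density \<mu> \<sigma>)" | c where "AE \<omega> in M. Y \<omega> = c"
    by (auto simp: gaussian_rv_def)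
  then show ?thesis
  proof cases
    case 1
    have \<mu>: "\<mu> = 0" using normal_distributed_expectation[OF 1] mean by simp
    have \<sigma>: "expectation (\<lambda>\<omega>. (Y \<omega>)\<^sup>2) = \<sigma>\<^sup>2" using normal_distributed_variance[OF 1] mean by simp
    have "distributed M lborel (\<lambda>\<omega>. (Y \<omega> - \<mu>) / \<sigma>) std_normal_density"
      using normal_standard_normal_convert[OF 1(1)] 1(2) by blast
    from distributed_distr_eq_density[OF this]
    have D: "distr M lborel (\<lambda>\<omega>. Y \<omega> / \<sigma>) = std_normal_distribution" by (simp add: \<mu>)
    have "(CLINT \<omega>|M. iexp (Y \<omega>)) = (CLINT \<omega>|M. iexp (\<sigma> * (Y \<omega> / \<sigma>)))"
      using 1(1) by simp
    also have "\<dots> = char std_normal_distribution \<sigma>"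
      unfolding char_def D[symmetric] by (subst integral_distr) auto
    finally show ?thesis by (simp add: \<sigma> char_std_normal_distribution)
  next
    case 2
    have "expectation Y = expectation (\<lambda>_. c)" using 2 by (intro integral_cong_AE) auto
    with mean have c: "c = 0" by (simp add: prob_space)
    have "expectation (\<lambda>\<omega>. (Y \<omega>)\<^sup>2) = expectation (\<lambda>_. 0)"
      using 2 by (intro integral_cong_AE) (auto simp: c)
    moreover have "(CLINT \<omega>|M. iexp (Y \<omega>)) = (CLINT \<omega>|M. 1)"
      using 2 by (intro integral_cong_AE) (auto simp: c)
    ultimately show ?thesis by (simp add: prob_space)
  qed
qed

text \<open>With identity covariance the variance of a combination is the sum of the squared
  coefficients, and the exponential of that sum is a product of standard normal characteristic
  functions. The marginals come from the same product formula as the independence.\<close>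

lemma (in prob_space) gaussian_orthonormal_iid:
  fixes X :: "'i \<Rightarrow> 'a \<Rightarrow> real"
  assumes I: "finite I" "I \<noteq> {}"
    and X: "\<And>i. i \<in> I \<Longrightarrow> integrable M (X i)"
    and g: "\<And>a. gaussian_rv M (\<lambda>\<omega>. \<Sum>i\<in>I. a i * X i \<omega>)"
    and mean: "\<And>i. i \<in> I \<Longrightarrow> expectation (X i) = 0"
    and int: "\<And>i j. i \<in> I \<Longrightarrow> j \<in> I \<Longrightarrow> integrable M (\<lambda>\<omega>. X i \<omega> * X j \<omega>)"
    and orth: "\<And>i j. i \<in> I \<Longrightarrow> j \<in> I \<Longrightarrow> expectation (\<lambda>\<omega>. X i \<omega> * X j \<omega>) = (if i = j then 1 else 0)"
  shows "indep_vars (\<lambda>_. borel) X I"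
    and "\<And>i. i \<in> I \<Longrightarrow> distributed M lborel (X i) std_normal_density"
proof -
  have Xm: "X i \<in> borel_measurable M" if "i \<in> I" for i using X[OF that] by simp
  have cf: "(CLINT \<omega>|M. iexp (\<Sum>i\<in>I. a i * X i \<omega>)) = (\<Prod>i\<in>I. char std_normal_distribution (a i))" for a
  proof -
    have "expectation (\<lambda>\<omega>. (\<Sum>i\<in>I. a i * X i \<omega>)\<^sup>2) = expectation (\<lambda>\<omega>. \<Sum>i\<in>I. \<Sum>j\<in>I. a i * a j * (X i \<omega> * X j \<omega>))"
      by (intro Bochner_Integration.integral_cong refl) (simp add: power2_eq_square sum_product mult_ac)
    also have "\<dots> = (\<Sum>i\<in>I. \<Sum>j\<in>I. a i * a j * (if i = j then 1 else 0))"
      using int orth by (simp add: Bochner_Integration.integral_sum)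
    also have "\<dots> = (\<Sum>i\<in>I. (a i)\<^sup>2)"
      using I by (simp add: if_distrib power2_eq_square cong: if_cong)
    finally have V: "expectation (\<lambda>\<omega>. (\<Sum>i\<in>I. a i * X i \<omega>)\<^sup>2) = (\<Sum>i\<in>I. (a i)\<^sup>2)" .
    have "expectation (\<lambda>\<omega>. \<Sum>i\<in>I. a i * X i \<omega>) = 0"
      using X mean by (simp add: Bochner_Integration.integral_sum)
    from gaussian_rv_char[OF g this]
    have "(CLINT \<omega>|M. iexp (\<Sum>i\<in>I. a i * X i \<omega>)) = complex_of_real (exp (\<Sum>i\<in>I. - (a i)\<^sup>2 / 2))"
      by (simp only: V sum_negf[symmetric] sum_divide_distrib)
    also have "\<dots> = (\<Prod>i\<in>I. complex_of_real (exp (- (a i)\<^sup>2 / 2)))"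
      using I by (simp only: exp_sum of_real_prod)
    finally show ?thesis by (simp only: char_std_normal_distribution)
  qed
  have joint: "prob {\<omega>\<in>space M. \<forall>i\<in>I. X i \<omega> \<in> A i} = (\<Prod>i\<in>I. measure std_normal_distribution (A i))"
    if "\<And>i. i \<in> I \<Longrightarrow> A i \<in> sets borel" for A
    by (rule prob_product_of_char_product[OF I(1) prob_space_axioms Xm real_dist_normal_dist cf that])
  have S1: "measure std_normal_distribution UNIV = 1"
    using real_distribution.axioms(1)[OF real_dist_normal_dist] prob_space.prob_space by fastforce
  have marg: "prob (X i -` B \<inter> space M) = measure std_normal_distribution B" if "i \<in> I" "B \<in> sets borel" for i B
  proof -
    \<comment> \<open>Taking \<open>UNIV\<close> for every other coordinate reads off a marginal
      from the joint formula.\<close>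
    have "X i -` B \<inter> space M = {\<omega>\<in>space M. \<forall>j\<in>I. X j \<omega> \<in> (if j = i then B else UNIV)}"
      using that by auto
    also have "prob \<dots> = (\<Prod>j\<in>I. measure std_normal_distribution (if j = i then B else UNIV))"
      using that by (intro joint) auto
    also have "\<dots> = (\<Prod>j\<in>I. if j = i then measure std_normal_distribution B else 1)"
      by (intro prod.cong refl) (use S1 in auto)
    finally show ?thesis using that I by simp
  qed
  show "distributed M lborel (X i) std_normal_density" if "i \<in> I" for i
    unfolding distributed_def
  proof (intro conjI)
    interpret S: real_distribution std_normal_distribution by (rule real_dist_normal_dist)
    show "distr M lborel (X i) = std_normal_distribution"
    proof (rule measure_eqI)
      fix B assume "B \<in> sets (distr M lborel (X i))"
      then have B: "B \<in> sets borel" by simp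
      have "emeasure (distr M lborel (X i)) B = emeasure M (X i -` B \<inter> space M)"
        using Xm[OF that] B by (subst emeasure_distr) auto
      also have "\<dots> = emeasure std_normal_distribution B"
        using marg[OF that B] by (simp add: emeasure_eq_measure S.emeasure_eq_measure)
      finally show "emeasure (distr M lborel (X i)) B = emeasure std_normal_distribution B" .
    qed simp
  qed (use Xm[OF that] in auto)
  show "indep_vars (\<lambda>_. borel) X I"
  proof (subst indep_vars_finite[OF I(2,1), where E = "\<lambda>_. sets borel"])
    show "\<forall>A\<in>\<Pi> i\<in>I. sets borel. prob (\<Inter>j\<in>I. X j -` A j \<inter> space M) = (\<Prod>j\<in>I. prob (X j -` A j \<inter> space M))"
    proof
      fix A assume A: "A \<in> (\<Pi> i\<in>I. sets (borel :: real measure))"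
      have "(\<Inter>j\<in>I. X j -` A j \<inter> space M) = {\<omega>\<in>space M. \<forall>i\<in>I. X i \<omega> \<in> A i}"
        using I by auto
      then show "prob (\<Inter>j\<in>I. X j -` A j \<inter> space M) = (\<Prod>j\<in>I. prob (X j -` A j \<inter> space M))"
        using A by (auto simp: joint marg Pi_def)
    qed
  qed (use Xm in \<open>auto simp: Int_stable_def sets.sigma_sets_eq[of borel, simplified]\<close>)
qed

section \<open>Gaussian mass of a planar wedge\<close>

text \<open>The factor \<open>u\<close>, which is the Jacobian of v = t * u, makes the Gaussian
  integrand an exact derivative. It is used with k = 1 + t^2, along the line of slope t.\<close>

lemma nn_integral_gaussian_tail:
  fixes k a :: real
  assumes k: "0 < k" and a: "0 \<le> a"
  shows "(\<integral>\<^sup>+u. ennreal (u * exp (- k * u\<^sup>2 / 2)) * indicator {a..} u \<partial>lborel) = ennreal (exp (- k * a\<^sup>2 / 2) / k)"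
proof -
  have lim: "((\<lambda>u. - exp (- k * u\<^sup>2 / 2) / k) \<longlongrightarrow> 0) at_top"
  proof -
    have "filterlim (\<lambda>u::real. (k/2) * u\<^sup>2) at_top at_top"
      using k by (intro filterlim_tendsto_pos_mult_at_top[OF tendsto_const] filterlim_pow_at_top filterlim_ident) auto
    then have "((\<lambda>u. exp (- ((k/2) * u\<^sup>2))) \<longlongrightarrow> 0) at_top"
      by (intro filterlim_compose[OF exp_at_bot]) (simp add: filterlim_uminus_at_top)
    from tendsto_divide[OF tendsto_minus[OF this] tendsto_const[of k]] k show ?thesis
      by (simp add: mult.commute)
  qed
  have "(\<integral>\<^sup>+u. ennreal (u * exp (- k * u\<^sup>2 / 2)) * indicator {a..} u \<partial>lborel)
      = ennreal (0 - (- exp (- k * a\<^sup>2 / 2) / k))"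
  proof (rule nn_integral_FTC_atLeast[OF _ _ _ lim])
    show "((\<lambda>u. - exp (- k * u\<^sup>2 / 2) / k) has_real_derivative x * exp (- k * x\<^sup>2 / 2)) (at x)" for x
      using k by (auto intro!: derivative_eq_intros simp: field_simps)
  qed (use a in auto)
  then show ?thesis by simp
qed

lemma nn_integral_abs_real:
  fixes f :: "real \<Rightarrow> ennreal"
  assumes [measurable]: "f \<in> borel_measurable borel"
  shows "(\<integral>\<^sup>+t. f \<bar>t\<bar> \<partial>lborel) = 2 * (\<integral>\<^sup>+t. f t * indicator {0..} t \<partial>lborel)"
proof -
  have "(\<integral>\<^sup>+t. f \<bar>t\<bar> \<partial>lborel) = (\<integral>\<^sup>+t. f t * indicator {0..} t + f (-t) * indicator {0..} (-t) \<partial>lborel)"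
    by (intro nn_integral_cong_AE AE_I[of _ _ "{0}"]) (auto simp: indicator_def)
  also have "\<dots> = (\<integral>\<^sup>+t. f t * indicator {0..} t \<partial>lborel) + (\<integral>\<^sup>+t. f (-t) * indicator {0..} (-t) \<partial>lborel)"
    by (rule nn_integral_add) auto
  also have "(\<integral>\<^sup>+t. f (-t) * indicator {0..} (-t) \<partial>lborel) = (\<integral>\<^sup>+t. f t * indicator {0..} t \<partial>lborel)"
    by (subst (2) nn_integral_real_affine[of _ "-1" 0]) auto
  finally show ?thesis by (simp add: mult_2)
qed

text \<open>The wedge is sliced along the lines v = t * u, that is, by the slope t = tan of the polar
  angle; this avoids a planar change of variables.\<close>

lemma nn_integral_gaussian_wedge:
  fixes \<alpha> b :: real
  assumes \<alpha>: "0 < \<alpha>" "\<alpha> < pi / 2" and b: "0 \<le> b"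
  shows "(\<integral>\<^sup>+u. \<integral>\<^sup>+v. ennreal (std_normal_density u) * ennreal (std_normal_density v) *
      indicator {(u, v). b \<le> sin \<alpha> * u - cos \<alpha> * \<bar>v\<bar>} (u, v) \<partial>lborel \<partial>lborel) =
    ennreal (1 / pi * (LBINT \<theta>:{0..\<alpha>}. exp (- (1/2) * b\<^sup>2 / (sin \<theta>)\<^sup>2)))" (is "?L = _")
proof -
  have sc: "0 < sin \<alpha>" "0 < cos \<alpha>" using \<alpha> by (auto intro!: sin_gt_zero cos_gt_zero)
  define G where "G = (\<lambda>t u. ennreal (u / (2 * pi) * exp (- (1 + t\<^sup>2) * u\<^sup>2 / 2)) *
      indicator {(t, u). 0 < u \<and> b \<le> u * (sin \<alpha> - cos \<alpha> * \<bar>t\<bar>)} (t, u))"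
  have G[measurable]: "(\<lambda>(t, u). G t u) \<in> borel_measurable (borel \<Otimes>\<^sub>M borel)"
    unfolding G_def by measurable
  have "?L = (\<integral>\<^sup>+u. \<integral>\<^sup>+t. G t u \<partial>lborel \<partial>lborel)"
  \<comment> \<open>The substitution v = u * t degenerates at u = 0, a null point. For u < 0 both
    integrands vanish, since b \<ge> 0 keeps the wedge out of that half-plane.\<close>
  proof (intro nn_integral_cong_AE AE_I[of _ _ "{0}"] subsetI)
    fix u assume "u \<in> {u \<in> space lborel. (\<integral>\<^sup>+v. ennreal (std_normal_density u) * ennreal (std_normal_density v) *
      indicator {(u, v). b \<le> sin \<alpha> * u - cos \<alpha> * \<bar>v\<bar>} (u, v) \<partial>lborel) \<noteq> (\<integral>\<^sup>+t. G t u \<partial>lborel)}"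
    then have ne: "(\<integral>\<^sup>+v. ennreal (std_normal_density u) * ennreal (std_normal_density v) *
      indicator {(u, v). b \<le> sin \<alpha> * u - cos \<alpha> * \<bar>v\<bar>} (u, v) \<partial>lborel) \<noteq> (\<integral>\<^sup>+t. G t u \<partial>lborel)" by simp
    show "u \<in> {0}"
    proof (rule ccontr)
      assume "u \<notin> {0}"
      then consider "u < 0" | "u > 0" by force
      then show False
      proof cases
        case 1
        have "\<not> b \<le> sin \<alpha> * u - cos \<alpha> * \<bar>v\<bar>" for v
          using mult_pos_neg[OF sc(1) 1] mult_nonneg_nonneg[of "cos \<alpha>" "\<bar>v\<bar>"] sc b by linarith
        then show False using ne 1 by (simp add: G_def)
      next
        case 2
        have "(\<integral>\<^sup>+v. ennreal (std_normal_density u) * ennreal (std_normal_density v) *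
          indicator {(u, v). b \<le> sin \<alpha> * u - cos \<alpha> * \<bar>v\<bar>} (u, v) \<partial>lborel)
          = ennreal \<bar>u\<bar> * (\<integral>\<^sup>+t. ennreal (std_normal_density u) * ennreal (std_normal_density (0 + u * t)) *
          indicator {(u, v). b \<le> sin \<alpha> * u - cos \<alpha> * \<bar>v\<bar>} (u, 0 + u * t) \<partial>lborel)"
          by (rule nn_integral_real_affine) (use 2 in auto)
        also have "\<dots> = (\<integral>\<^sup>+t. ennreal \<bar>u\<bar> * (ennreal (std_normal_density u) * ennreal (std_normal_density (0 + u * t)) *
          indicator {(u, v). b \<le> sin \<alpha> * u - cos \<alpha> * \<bar>v\<bar>} (u, 0 + u * t)) \<partial>lborel)"
          by (rule nn_integral_cmult[symmetric]) measurable
        also have "\<dots> = (\<integral>\<^sup>+t. G t u \<partial>lborel)"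
        proof (intro nn_integral_cong)
          fix t
          have "u * (std_normal_density u * std_normal_density (u * t)) = u / (2 * pi) * exp (- (1 + t\<^sup>2) * u\<^sup>2 / 2)"
            by (simp add: std_normal_density_def exp_add[symmetric] power_mult_distrib field_simps)
          moreover have "(b \<le> sin \<alpha> * u - cos \<alpha> * \<bar>u * t\<bar>) = (b \<le> u * (sin \<alpha> - cos \<alpha> * \<bar>t\<bar>))"
            using 2 by (simp add: abs_mult algebra_simps)
          ultimately show "ennreal \<bar>u\<bar> * (ennreal (std_normal_density u) * ennreal (std_normal_density (0 + u * t)) *
              indicator {(u, v). b \<le> sin \<alpha> * u - cos \<alpha> * \<bar>v\<bar>} (u, 0 + u * t)) = G t u"
            using 2 by (simp add: G_def indicator_def ennreal_mult'[symmetric])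
        qed
        finally show False using ne by simp
      qed
    qed
  qed auto
  \<comment> \<open>With the slope as the outer variable, the inner integral runs along a ray and is
    elementary.\<close>
  also have "\<dots> = (\<integral>\<^sup>+t. \<integral>\<^sup>+u. G t u \<partial>lborel \<partial>lborel)"
    by (rule lborel_pair.Fubini') measurable
  also have "\<dots> = (\<integral>\<^sup>+t. ennreal (exp (- (1 + \<bar>t\<bar>\<^sup>2) * b\<^sup>2 / (2 * (sin \<alpha> - cos \<alpha> * \<bar>t\<bar>)\<^sup>2)) / (2 * pi * (1 + \<bar>t\<bar>\<^sup>2))) *
      indicator {..tan \<alpha>} \<bar>t\<bar> \<partial>lborel)"
  \<comment> \<open>On the two boundary slopes the denominator is 0 and the quotient takes the value
    0 by default, so the formula may fail there; they form a null set.\<close>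
  proof (intro nn_integral_cong_AE AE_I[of _ _ "{tan \<alpha>, - tan \<alpha>}"] subsetI)
    fix t assume "t \<in> {t \<in> space lborel. (\<integral>\<^sup>+u. G t u \<partial>lborel) \<noteq>
       ennreal (exp (- (1 + \<bar>t\<bar>\<^sup>2) * b\<^sup>2 / (2 * (sin \<alpha> - cos \<alpha> * \<bar>t\<bar>)\<^sup>2)) / (2 * pi * (1 + \<bar>t\<bar>\<^sup>2))) *
      indicator {..tan \<alpha>} \<bar>t\<bar>}"
    then have ne: "(\<integral>\<^sup>+u. G t u \<partial>lborel) \<noteq>
       ennreal (exp (- (1 + \<bar>t\<bar>\<^sup>2) * b\<^sup>2 / (2 * (sin \<alpha> - cos \<alpha> * \<bar>t\<bar>)\<^sup>2)) / (2 * pi * (1 + \<bar>t\<bar>\<^sup>2))) *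
      indicator {..tan \<alpha>} \<bar>t\<bar>" by simp
    define c where "c = sin \<alpha> - cos \<alpha> * \<bar>t\<bar>"
    have tan: "\<bar>t\<bar> < tan \<alpha> \<longleftrightarrow> 0 < c" "\<bar>t\<bar> = tan \<alpha> \<longleftrightarrow> c = 0"
      using sc by (auto simp: c_def tan_def field_simps)
    show "t \<in> {tan \<alpha>, - tan \<alpha>}"
    proof (rule ccontr)
      assume "t \<notin> {tan \<alpha>, - tan \<alpha>}"
      then have "\<bar>t\<bar> \<noteq> tan \<alpha>" by auto
      with tan consider "c < 0" "tan \<alpha> < \<bar>t\<bar>" | "c > 0" "\<bar>t\<bar> < tan \<alpha>" by linarith
      then show False
      proof cases
        case 1
        have "\<not> (0 < u \<and> b \<le> u * c)" for u
          using mult_pos_neg[of u c] 1 b by auto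
        then have "G t u = 0" for u by (simp add: G_def c_def)
        then show False using ne 1 by simp
      next
        case 2
        have "G t u = ennreal (1 / (2 * pi)) * (ennreal (u * exp (- (1 + t\<^sup>2) * u\<^sup>2 / 2)) * indicator {b / c..} u)" for u
        proof -
          \<comment> \<open>For b = 0 the closed half-line contains u = 0, which \<open>G\<close>
            excludes; the factor \<open>u\<close> makes the integrand 0 at that point.\<close>
          have "0 < u \<and> b \<le> u * c \<longleftrightarrow> b / c \<le> u \<and> u \<noteq> 0"
            unfolding pos_divide_le_eq[OF 2(1), symmetric] using divide_nonneg_pos[OF b 2(1)] by linarith
          then have "indicator {(t, u). 0 < u \<and> b \<le> u * (sin \<alpha> - cos \<alpha> * \<bar>t\<bar>)} (t, u) = (if u = 0 then 0 else indicator {b / c..} u :: ennreal)"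
            by (auto simp: c_def indicator_def)
          then show ?thesis
            by (auto simp: G_def indicator_def ennreal_mult'[symmetric])
        qed
        then have "(\<integral>\<^sup>+u. G t u \<partial>lborel) = ennreal (1 / (2 * pi)) * (\<integral>\<^sup>+u. ennreal (u * exp (- (1 + t\<^sup>2) * u\<^sup>2 / 2)) * indicator {b / c..} u \<partial>lborel)"
          by (simp add: nn_integral_cmult)
        also have "\<dots> = ennreal (1 / (2 * pi)) * ennreal (exp (- (1 + t\<^sup>2) * (b / c)\<^sup>2 / 2) / (1 + t\<^sup>2))"
          using 2 b by (subst nn_integral_gaussian_tail) (auto simp: add_pos_nonneg)
        also have "\<dots> = ennreal (exp (- (1 + \<bar>t\<bar>\<^sup>2) * b\<^sup>2 / (2 * c\<^sup>2)) / (2 * pi * (1 + \<bar>t\<bar>\<^sup>2)))"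
          by (simp add: ennreal_mult'[symmetric] power_divide mult.commute)
        finally show False using ne 2 by (simp add: c_def)
      qed
    qed
  qed (auto simp: emeasure_lborel_countable)
  also have "\<dots> = 2 * (\<integral>\<^sup>+t. ennreal (exp (- (1 + t\<^sup>2) * b\<^sup>2 / (2 * (sin \<alpha> - cos \<alpha> * t)\<^sup>2)) / (2 * pi * (1 + t\<^sup>2))) *
      indicator {..tan \<alpha>} t * indicator {0..} t \<partial>lborel)"
    by (rule nn_integral_abs_real) measurable
  also have "\<dots> = 2 * (\<integral>\<^sup>+t. ennreal (exp (- (1 + t\<^sup>2) * b\<^sup>2 / (2 * (sin \<alpha> - cos \<alpha> * t)\<^sup>2)) / (2 * pi * (1 + t\<^sup>2)) *
      indicator {tan 0..tan \<alpha>} t) \<partial>lborel)"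
    by (intro arg_cong[where f="\<lambda>x. 2 * x"] nn_integral_cong) (auto simp: indicator_def)
  also have "\<dots> = 2 * (\<integral>\<^sup>+\<psi>. ennreal (exp (- (1 + (tan \<psi>)\<^sup>2) * b\<^sup>2 / (2 * (sin \<alpha> - cos \<alpha> * tan \<psi>)\<^sup>2)) / (2 * pi * (1 + (tan \<psi>)\<^sup>2)) *
      inverse ((cos \<psi>)\<^sup>2) * indicator {0..\<alpha>} \<psi>) \<partial>lborel)"
  proof -
    have "cos x \<noteq> 0" if "x \<in> {0..\<alpha>}" for x
      using cos_gt_zero_pi[of x] that \<alpha> by auto
    then show ?thesis
      by (intro arg_cong[where f="\<lambda>x. 2 * x"] nn_integral_substitution)
         (use \<alpha> in \<open>auto intro!: derivative_eq_intros continuous_intros simp: set_borel_measurable_def\<close>)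
  qed
  \<comment> \<open>The derivative of tan cancels 1 + (tan \<psi>)^2, and sin \<alpha> - cos
    \<alpha> * tan \<psi> equals sin (\<alpha> - \<psi>) / cos \<psi>. So \<alpha> - \<psi>, the
    angle measured from the edge of the wedge, is the variable \<theta> of \<open>Q\<close>.\<close>
  also have "\<dots> = 2 * (\<integral>\<^sup>+\<psi>. ennreal (1 / (2 * pi) * (exp (- (1/2) * b\<^sup>2 / (sin (\<alpha> - \<psi>))\<^sup>2) * indicator {0..\<alpha>} (\<alpha> - \<psi>))) \<partial>lborel)"
  proof (intro arg_cong[where f="\<lambda>x. 2 * x"] nn_integral_cong arg_cong[where f=ennreal])
    fix \<psi>
    show "exp (- (1 + (tan \<psi>)\<^sup>2) * b\<^sup>2 / (2 * (sin \<alpha> - cos \<alpha> * tan \<psi>)\<^sup>2)) / (2 * pi * (1 + (tan \<psi>)\<^sup>2)) *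
      inverse ((cos \<psi>)\<^sup>2) * indicator {0..\<alpha>} \<psi> = 1 / (2 * pi) * (exp (- (1/2) * b\<^sup>2 / (sin (\<alpha> - \<psi>))\<^sup>2) * indicator {0..\<alpha>} (\<alpha> - \<psi>))"
    proof (cases "\<psi> \<in> {0..\<alpha>}")
      case True
      then have c: "cos \<psi> > 0" using cos_gt_zero_pi[of \<psi>] \<alpha> by auto
      have "sin \<alpha> - cos \<alpha> * tan \<psi> = sin (\<alpha> - \<psi>) / cos \<psi>"
        using c by (simp add: sin_diff tan_def field_simps)
      moreover have "1 + (tan \<psi>)\<^sup>2 = 1 / (cos \<psi>)\<^sup>2"
        using tan_sec[of \<psi>] c by (simp add: inverse_eq_divide power_divide)
      ultimately show ?thesis using True c by (simp add: power_divide)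
    qed (auto simp: indicator_def)
  qed
  also have "\<dots> = 2 * (\<integral>\<^sup>+\<theta>. ennreal (1 / (2 * pi) * (exp (- (1/2) * b\<^sup>2 / (sin \<theta>)\<^sup>2) * indicator {0..\<alpha>} \<theta>)) \<partial>lborel)"
    by (subst (2) nn_integral_real_affine[of _ "-1" \<alpha>]) auto
  also have "\<dots> = 2 * ennreal (1 / (2 * pi) * (LBINT \<theta>:{0..\<alpha>}. exp (- (1/2) * b\<^sup>2 / (sin \<theta>)\<^sup>2)))"
  proof -
    have "set_integrable lborel {0..\<alpha>} (\<lambda>\<theta>. exp (- (1/2) * b\<^sup>2 / (sin \<theta>)\<^sup>2))"
      unfolding set_integrable_def
      by (rule integrableI_bounded_set_indicator[where B = 1]) (use \<alpha> in auto)
    then have "integrable lborel (\<lambda>\<theta>. 1 / (2 * pi) * (exp (- (1/2) * b\<^sup>2 / (sin \<theta>)\<^sup>2) * indicator {0..\<alpha>} \<theta>))"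
      by (simp add: set_integrable_def mult.commute)
    then show ?thesis
      by (subst nn_integral_eq_integral) (auto simp: set_lebesgue_integral_def mult.commute)
  qed
  also have "\<dots> = ennreal (1 / pi * (LBINT \<theta>:{0..\<alpha>}. exp (- (1/2) * b\<^sup>2 / (sin \<theta>)\<^sup>2)))"
    by (subst ennreal_numeral[symmetric], subst ennreal_mult'[symmetric]) auto
  finally show ?thesis .
qed

section \<open>Probability that two correlated normal variables lie below a threshold\<close>

lemma (in prob_space) distributed_std_normal_cdf:
  assumes W: "distributed M lborel W std_normal_density"
  shows "prob {\<omega>\<in>space M. W \<omega> < b} = std_normal_cdf b"
    and "prob {\<omega>\<in>space M. W \<omega> = b} = 0"
proof -
  have [measurable]: "W \<in> borel_measurable M" using distributed_measurable[OF W] by simp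
  have "emeasure M (W -` {b} \<inter> space M) = 0"
    by (subst distributed_emeasure[OF W]) (auto simp: nn_integral_0_iff_AE intro!: AE_I[of _ _ "{b}"])
  moreover have "W -` {b} \<inter> space M = {\<omega>\<in>space M. W \<omega> = b}" by auto
  ultimately show z: "prob {\<omega>\<in>space M. W \<omega> = b} = 0" by (simp add: measure_def)
  have "distr M borel W = distr M lborel W" by (rule distr_cong) auto
  then have "distr M borel W = std_normal_distribution"
    using distributed_distr_eq_density[OF W] by simp
  then have "std_normal_cdf b = measure (distr M borel W) {..b}"
    by (simp add: std_normal_cdf_def cdf_def)
  also have "\<dots> = prob {\<omega>\<in>space M. W \<omega> \<le> b}"
    by (subst measure_distr) (auto intro!: arg_cong[where f=prob])
  also have "{\<omega>\<in>space M. W \<omega> \<le> b} = {\<omega>\<in>space M. W \<omega> < b} \<union> {\<omega>\<in>space M. W \<omega> = b}" by auto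
  also have "prob \<dots> = prob {\<omega>\<in>space M. W \<omega> < b}"
    using z by (subst finite_measure_Union) auto
  finally show "prob {\<omega>\<in>space M. W \<omega> < b} = std_normal_cdf b" ..
qed

text \<open>On the standard normal law itself, the identity and its negative are both standard
  normal. The two open half-lines thus have equal mass, and the origin has none.\<close>

lemma std_normal_cdf_0: "std_normal_cdf 0 = 1 / 2"
proof -
  interpret D: real_distribution std_normal_distribution by (rule real_dist_normal_dist)
  have "distr std_normal_distribution lborel (\<lambda>x. x) = distr std_normal_distribution std_normal_distribution (\<lambda>x. x)"
    by (rule distr_cong) auto
  then have U: "distributed std_normal_distribution lborel (\<lambda>x. x) std_normal_density"
    by (simp add: distributed_def distr_id[unfolded id_def])
  then have U': "distributed std_normal_distribution lborel (\<lambda>x. - x) std_normal_density"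
    using D.normal_density_affine[OF U, of "-1" 0] by simp
  have UN: "space std_normal_distribution = {x\<in>space std_normal_distribution. x < 0} \<union>
      {x\<in>space std_normal_distribution. - x < 0} \<union> {x\<in>space std_normal_distribution. x = 0}"
    by auto
  have "1 = D.prob (space std_normal_distribution)"
    by (rule D.prob_space[symmetric])
  also have "\<dots> = D.prob {x\<in>space std_normal_distribution. x < 0} + D.prob {x\<in>space std_normal_distribution. - x < 0} +
      D.prob {x\<in>space std_normal_distribution. x = 0}"
    by (subst UN, subst D.finite_measure_Union, simp, simp, force, subst D.finite_measure_Union) auto
  finally show ?thesis
    unfolding D.distributed_std_normal_cdf[OF U] D.distributed_std_normal_cdf[OF U'] by simp
qed

lemma (in prob_space) prob_gaussian_wedge:
  assumes U: "distributed M lborel U std_normal_density" and V: "distributed M lborel V std_normal_density"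
    and indep: "indep_var borel U borel V"
    and \<alpha>: "0 < \<alpha>" "\<alpha> < pi / 2" and b: "0 \<le> b"
  shows "prob {\<omega>\<in>space M. b \<le> sin \<alpha> * U \<omega> - cos \<alpha> * \<bar>V \<omega>\<bar>} =
    1 / pi * (LBINT \<theta>:{0..\<alpha>}. exp (- (1/2) * b\<^sup>2 / (sin \<theta>)\<^sup>2))"
proof -
  have ind: "indep_var lborel U lborel V"
    using indep unfolding indep_var_eq by simp
  note D = distributed_joint_indep[OF sigma_finite_lborel sigma_finite_lborel U V ind]
  define S where "S = {(u, v). b \<le> sin \<alpha> * u - cos \<alpha> * \<bar>v\<bar>}"
  have S: "S \<in> sets (lborel \<Otimes>\<^sub>M lborel)"
  proof -
    have "S = {p\<in>space (lborel \<Otimes>\<^sub>M lborel). b \<le> sin \<alpha> * fst p - cos \<alpha> * \<bar>snd p\<bar>}"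
      by (auto simp: S_def space_pair_measure)
    also have "\<dots> \<in> sets (lborel \<Otimes>\<^sub>M lborel)" by measurable
    finally show ?thesis .
  qed
  have "emeasure M {\<omega>\<in>space M. b \<le> sin \<alpha> * U \<omega> - cos \<alpha> * \<bar>V \<omega>\<bar>} = emeasure M ((\<lambda>x. (U x, V x)) -` S \<inter> space M)"
    by (intro arg_cong[where f="emeasure M"]) (auto simp: S_def)
  also have "\<dots> = (\<integral>\<^sup>+p. (case p of (u, v) \<Rightarrow> ennreal (std_normal_density u) * ennreal (std_normal_density v)) * indicator S p \<partial>(lborel \<Otimes>\<^sub>M lborel))"
    by (rule distributed_emeasure[OF D S])
  also have "\<dots> = (\<integral>\<^sup>+u. \<integral>\<^sup>+v. ennreal (std_normal_density u) * ennreal (std_normal_density v) * indicator S (u, v) \<partial>lborel \<partial>lborel)"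
    using S by (subst lborel.nn_integral_fst[symmetric]) auto
  also have "\<dots> = ennreal (1 / pi * (LBINT \<theta>:{0..\<alpha>}. exp (- (1/2) * b\<^sup>2 / (sin \<theta>)\<^sup>2)))"
    unfolding S_def by (rule nn_integral_gaussian_wedge[OF \<alpha> b])
  finally show ?thesis
    by (simp add: measure_def set_lebesgue_integral_def)
qed

lemma (in prob_space) distributed_rotation:
  assumes U: "distributed M lborel U std_normal_density" and V: "distributed M lborel V std_normal_density"
    and indep: "indep_var borel U borel V" and pq: "p\<^sup>2 + q\<^sup>2 = 1" "p \<noteq> 0" "q \<noteq> 0"
  shows "distributed M lborel (\<lambda>\<omega>. p * U \<omega> + q * V \<omega>) std_normal_density"
proof -
  have 1: "indep_var borel (\<lambda>\<omega>. p * U \<omega>) borel (\<lambda>\<omega>. q * V \<omega>)"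
    using indep_var_compose[OF indep, of "\<lambda>x. p * x" borel "\<lambda>x. q * x" borel] by (simp add: comp_def)
  have 2: "distributed M lborel (\<lambda>\<omega>. p * U \<omega>) (normal_density 0 \<bar>p\<bar>)"
    using normal_density_affine[OF U, of p 0] pq by simp
  have 3: "distributed M lborel (\<lambda>\<omega>. q * V \<omega>) (normal_density 0 \<bar>q\<bar>)"
    using normal_density_affine[OF V, of q 0] pq by simp
  show ?thesis using add_indep_normal[OF 1 _ _ 2 3] pq by simp
qed

text \<open>The left variable is the maximum of the two rotated variables \<open>W1\<close> and
  \<open>W2\<close>, and sin \<alpha> * U - cos \<alpha> * \<bar>V\<bar> is their minimum. The wedge
  is the event that the minimum is at least b, so for b \<ge> 0 inclusion-exclusion passes from
  minimum to maximum.\<close>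

lemma (in prob_space) prob_rotated_max_less:
  assumes U: "distributed M lborel U std_normal_density" and V: "distributed M lborel V std_normal_density"
    and indep: "indep_var borel U borel V"
    and \<alpha>: "0 < \<alpha>" "\<alpha> < pi / 2"
  shows "prob {\<omega>\<in>space M. sin \<alpha> * U \<omega> + cos \<alpha> * \<bar>V \<omega>\<bar> < b} =
    1 - 2 * (1 - std_normal_cdf (max b 0)) + 1 / pi * (LBINT \<theta>:{0..\<alpha>}. exp (- (1/2) * b\<^sup>2 / (sin \<theta>)\<^sup>2))"
proof -
  have [measurable]: "U \<in> borel_measurable M" "V \<in> borel_measurable M"
    using distributed_measurable[OF U] distributed_measurable[OF V] by auto
  have sc: "0 < sin \<alpha>" "0 < cos \<alpha>" using \<alpha> by (auto intro!: sin_gt_zero cos_gt_zero)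
  define W1 where "W1 = (\<lambda>\<omega>. sin \<alpha> * U \<omega> + cos \<alpha> * V \<omega>)"
  define W2 where "W2 = (\<lambda>\<omega>. sin \<alpha> * U \<omega> + (- cos \<alpha>) * V \<omega>)"
  have W1: "distributed M lborel W1 std_normal_density"
    unfolding W1_def using sc by (intro distributed_rotation[OF U V indep]) auto
  have W2: "distributed M lborel W2 std_normal_density"
    unfolding W2_def using sc by (intro distributed_rotation[OF U V indep]) auto
  have [measurable]: "W1 \<in> borel_measurable M" "W2 \<in> borel_measurable M"
    by (auto simp: W1_def W2_def)
  show ?thesis
  proof (cases "0 \<le> b")
    case True
    have "cos \<alpha> * \<bar>x\<bar> = \<bar>cos \<alpha> * x\<bar>" for x using sc by (simp add: abs_mult)
    then have mx: "sin \<alpha> * U \<omega> + cos \<alpha> * \<bar>V \<omega>\<bar> = max (W1 \<omega>) (W2 \<omega>)"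
        "sin \<alpha> * U \<omega> - cos \<alpha> * \<bar>V \<omega>\<bar> = min (W1 \<omega>) (W2 \<omega>)" for \<omega>
      by (simp_all add: W1_def W2_def)
    have u: "prob ({\<omega>\<in>space M. W1 \<omega> < b} \<union> {\<omega>\<in>space M. W2 \<omega> < b}) =
      1 - 1 / pi * (LBINT \<theta>:{0..\<alpha>}. exp (- (1/2) * b\<^sup>2 / (sin \<theta>)\<^sup>2))"
    proof -
      have "{\<omega>\<in>space M. W1 \<omega> < b} \<union> {\<omega>\<in>space M. W2 \<omega> < b} = space M - {\<omega>\<in>space M. b \<le> sin \<alpha> * U \<omega> - cos \<alpha> * \<bar>V \<omega>\<bar>}"
        unfolding mx by auto
      then show ?thesis
        using prob_gaussian_wedge[OF U V indep \<alpha> True] by (simp add: prob_compl)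
    qed
    have "prob {\<omega>\<in>space M. sin \<alpha> * U \<omega> + cos \<alpha> * \<bar>V \<omega>\<bar> < b} =
        prob ({\<omega>\<in>space M. W1 \<omega> < b} \<inter> {\<omega>\<in>space M. W2 \<omega> < b})"
      unfolding mx by (intro arg_cong[where f=prob]) auto
    also have "\<dots> = prob {\<omega>\<in>space M. W1 \<omega> < b} + prob {\<omega>\<in>space M. W2 \<omega> < b} -
        prob ({\<omega>\<in>space M. W1 \<omega> < b} \<union> {\<omega>\<in>space M. W2 \<omega> < b})"
      by (subst measure_Un3) (auto simp: fmeasurable_eq_sets)
    finally show ?thesis
      unfolding u distributed_std_normal_cdf[OF W1] distributed_std_normal_cdf[OF W2]
      using True by (simp add: max_def)
  next
    case False
    \<comment> \<open>Reflecting U turns "maximum below b" into "minimum at least -b", a wedge with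
      positive threshold.\<close>
    define U' where "U' = (\<lambda>\<omega>. - U \<omega>)"
    have [measurable]: "U' \<in> borel_measurable M" by (simp add: U'_def)
    have U': "distributed M lborel U' std_normal_density"
      using normal_density_affine[OF U, of "-1" 0] by (simp add: U'_def)
    have indep': "indep_var borel U' borel V"
      using indep_var_compose[OF indep, of "\<lambda>x. - x" borel "\<lambda>x. x" borel] by (simp add: comp_def U'_def)
    have "prob {\<omega>\<in>space M. - b \<le> sin \<alpha> * U' \<omega> - cos \<alpha> * \<bar>V \<omega>\<bar>} =
      1 / pi * (LBINT \<theta>:{0..\<alpha>}. exp (- (1/2) * b\<^sup>2 / (sin \<theta>)\<^sup>2))"
      using prob_gaussian_wedge[OF U' V indep' \<alpha>, of "-b"] False by simp
    \<comment> \<open>The reflected event has a weak inequality; the two differ only where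
      \<open>W1\<close> or \<open>W2\<close> equals b.\<close>
    moreover have "prob {\<omega>\<in>space M. sin \<alpha> * U \<omega> + cos \<alpha> * \<bar>V \<omega>\<bar> < b} =
       prob {\<omega>\<in>space M. - b \<le> sin \<alpha> * U' \<omega> - cos \<alpha> * \<bar>V \<omega>\<bar>}"
    proof (rule finite_measure_eq_AE)
      have "AE \<omega> in M. W \<omega> \<noteq> b" if "distributed M lborel W std_normal_density" for W
        using distributed_std_normal_cdf(2)[OF that, of b] distributed_measurable[OF that]
        by (subst AE_iff_measurable[OF _ refl]) (auto simp: emeasure_eq_measure)
      from this[OF W1] this[OF W2]
      show "AE \<omega> in M. (\<omega> \<in> {\<omega>\<in>space M. sin \<alpha> * U \<omega> + cos \<alpha> * \<bar>V \<omega>\<bar> < b}) =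
        (\<omega> \<in> {\<omega>\<in>space M. - b \<le> sin \<alpha> * U' \<omega> - cos \<alpha> * \<bar>V \<omega>\<bar>})"
        by eventually_elim (auto simp: W1_def W2_def U'_def abs_if split: if_splits)
    qed measurable
    ultimately show ?thesis using False by (simp add: max_def std_normal_cdf_0)
  qed
qed

section \<open>The function Q\<close>

lemma std_normal_cdf_ge_half:
  assumes "0 \<le> x"
  shows "1 / 2 \<le> std_normal_cdf x"
proof -
  interpret D: real_distribution std_normal_distribution by (rule real_dist_normal_dist)
  show ?thesis
    using D.cdf_nondecreasing[OF assms] std_normal_cdf_0 by (simp add: std_normal_cdf_def)
qed

text \<open>Two standardised variables with correlation - r^2 have half-sum and half-difference of
  variance (1 - r^2) / 2 and (1 + r^2) / 2. The sine and cosine of this angle are the two standard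
  deviations.\<close>

lemma alpha_coef_bounds:
  assumes r: "0 < r" "r < 1"
  shows "0 < alpha_coef r" "alpha_coef r < pi / 2"
    and "sin (alpha_coef r) = sqrt ((1 - r\<^sup>2) / 2)" "cos (alpha_coef r) = sqrt ((1 + r\<^sup>2) / 2)"
proof -
  have r2: "0 < r\<^sup>2" "r\<^sup>2 < 1" using r by (auto simp: power_less_one_iff abs_square_less_1)
  have "0 < (1 - r\<^sup>2) / 2" "(1 - r\<^sup>2) / 2 < 1"
    using r2 by argo+
  then have s: "0 < sqrt ((1 - r\<^sup>2) / 2)" "sqrt ((1 - r\<^sup>2) / 2) < 1"
    by (simp_all only: real_sqrt_lt_1_iff real_sqrt_gt_0_iff)
  show "sin (alpha_coef r) = sqrt ((1 - r\<^sup>2) / 2)"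
    unfolding alpha_coef_def using s by (intro sin_arcsin) linarith+
  have "cos (alpha_coef r) = sqrt (1 - (sqrt ((1 - r\<^sup>2) / 2))\<^sup>2)"
    unfolding alpha_coef_def using s by (intro cos_arcsin) linarith+
  also have "1 - (sqrt ((1 - r\<^sup>2) / 2))\<^sup>2 = (1 + r\<^sup>2) / 2"
    using r2 by (simp add: field_simps)
  finally show "cos (alpha_coef r) = sqrt ((1 + r\<^sup>2) / 2)" .
  show "0 < alpha_coef r" "alpha_coef r < pi / 2"
    using arcsin_less_mono[of 0 "sqrt ((1 - r\<^sup>2) / 2)"] arcsin_less_mono[of "sqrt ((1 - r\<^sup>2) / 2)" 1] s
    unfolding alpha_coef_def by auto
qed

text \<open>Serves twice: for the angular integral inside \<open>Q\<close> and for the normalising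
  constant of the peak density.\<close>

lemma integral_pos_of_pos_on:
  fixes f :: "'a \<Rightarrow> real"
  assumes f: "integrable M f" and S: "S \<in> sets M" "emeasure M S \<noteq> 0"
    and nonneg: "\<And>x. 0 \<le> f x" and pos: "\<And>x. x \<in> S \<Longrightarrow> 0 < f x"
  shows "0 < integral\<^sup>L M f"
proof (rule ccontr)
  assume "\<not> 0 < integral\<^sup>L M f"
  then have "integral\<^sup>L M f = 0"
    using Bochner_Integration.integral_nonneg[of M f] nonneg by (simp add: order_antisym)
  then have "AE x in M. f x = 0"
    using integral_nonneg_eq_0_iff_AE[OF f] nonneg by simp
  then have "AE x in M. x \<notin> S"
    by eventually_elim (use pos in force)
  then show False
    using S by (simp add: AE_iff_measurable[OF S(1)] sets.sets_into_space subset_eq Collect_conj_eq Int_absorb1)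
qed

text \<open>The normal term is nonnegative because h * max z 0 lies in the half-line where the
  distribution function is at least 1/2, and the angular integral is strictly positive because its
  interval has positive length. Strictness is what gives the peak event positive
  probability.\<close>

lemma Q_pos:
  assumes r: "0 < r" "r < 1"
  shows "0 < Q r z"
proof -
  note a = alpha_coef_bounds[OF r]
  let ?f = "\<lambda>\<theta>. exp (- (1/2) * (h_coef r)\<^sup>2 * z\<^sup>2 / (sin \<theta>)\<^sup>2)"
  have "set_integrable lborel {0..alpha_coef r} ?f"
    unfolding set_integrable_def
    by (rule integrableI_bounded_set_indicator[where B = 1]) (use a in auto)
  then have i: "integrable lborel (\<lambda>\<theta>. indicator {0..alpha_coef r} \<theta> * ?f \<theta>)"
    by (simp add: set_integrable_def)
  have "0 < (LINT \<theta>|lborel. indicator {0..alpha_coef r} \<theta> * ?f \<theta>)"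
    by (rule integral_pos_of_pos_on[OF i, of "{0..alpha_coef r}"]) (use a in auto)
  moreover have "0 \<le> h_coef r * max z 0" using r by (simp add: h_coef_def)
  from std_normal_cdf_ge_half[OF this] have "0 \<le> 1 - 2 * (1 - std_normal_cdf (h_coef r * max z 0))" by simp
  ultimately show ?thesis
    unfolding Q_def set_lebesgue_integral_def by (intro add_nonneg_pos) auto
qed

lemma Q_measurable [measurable]: "Q r \<in> borel_measurable borel"
proof -
  interpret D: real_distribution std_normal_distribution by (rule real_dist_normal_dist)
  have [measurable]: "std_normal_cdf \<in> borel_measurable borel"
    unfolding std_normal_cdf_def
    by (intro borel_measurable_mono monoI D.cdf_nondecreasing)
  show ?thesis
    unfolding Q_def[abs_def] set_lebesgue_integral_def by measurable
qed

text \<open>This is the probabilistic meaning of \<open>Q\<close>: the larger of the two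
  standardised residuals in one direction stays below h z. As h \<ge> 0, the positive part of h z is
  h times that of z.\<close>

lemma (in prob_space) Q_eq_prob:
  assumes r: "0 < r" "r < 1"
    and U: "distributed M lborel U std_normal_density" and V: "distributed M lborel V std_normal_density"
    and indep: "indep_var borel U borel V"
  shows "prob {\<omega>\<in>space M. sqrt ((1 - r\<^sup>2) / 2) * U \<omega> + sqrt ((1 + r\<^sup>2) / 2) * \<bar>V \<omega>\<bar> < h_coef r * z} = Q r z"
proof -
  note a = alpha_coef_bounds[OF r]
  have h: "0 \<le> h_coef r" using r by (simp add: h_coef_def)
  have "max (h_coef r * z) 0 = h_coef r * max z 0"
    using h by (auto simp: max_def mult_le_0_iff zero_le_mult_iff)
  then show ?thesis
    using prob_rotated_max_less[OF U V indep a(1,2), of "h_coef r * z"]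
    by (simp add: Q_def a power_mult_distrib)
qed

section \<open>Law of the centre on the event of a peak\<close>

text \<open>The index \<open>None\<close> is the centre, \<open>Some d\<close> a direction. The
  centre is independent of the block of all directions, so the joint law is a product measure and
  Fubini fixes the value z; independence among the directions then factors each slice.\<close>

lemma (in prob_space) emeasure_indep_random_threshold:
  fixes T :: "'d::finite option \<Rightarrow> 'a \<Rightarrow> real" and h :: "'d \<Rightarrow> real"
  assumes ind: "indep_vars (\<lambda>_. borel) T UNIV" and A[measurable]: "A \<in> sets borel"
  shows "emeasure M {\<omega>\<in>space M. T None \<omega> \<in> A \<and> (\<forall>d. T (Some d) \<omega> < h d * T None \<omega>)} =
    (\<integral>\<^sup>+z. ennreal (\<Prod>d\<in>UNIV. prob {\<omega>\<in>space M. T (Some d) \<omega> < h d * z}) * indicator A z \<partial>distr M borel (T None))"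
proof -
  have T[measurable]: "T i \<in> borel_measurable M" for i
    using ind by (auto simp: indep_vars_def)
  define P where "P = (\<lambda>J :: 'd option set. \<Pi>\<^sub>M i\<in>J. (borel :: real measure))"
  define R where "R = (\<lambda>J \<omega>. restrict (\<lambda>i. T i \<omega>) J)"
  have "indep_var (P {None}) (R {None}) (P (range Some)) (R (range Some))"
    unfolding P_def R_def by (rule indep_var_restrict[OF ind]) auto
  then have eq: "distr M (P {None}) (R {None}) \<Otimes>\<^sub>M distr M (P (range Some)) (R (range Some)) =
      distr M (P {None} \<Otimes>\<^sub>M P (range Some)) (\<lambda>\<omega>. (R {None} \<omega>, R (range Some) \<omega>))"
    unfolding indep_var_distribution_eq by auto
  have R[measurable]: "R J \<in> measurable M (P J)" for J
    unfolding P_def R_def by measurable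
  have comp: "(\<lambda>f. f i) \<in> borel_measurable (P J)" if "i \<in> J" for i J
    unfolding P_def using that by (rule measurable_component_singleton)
  interpret DR: prob_space "distr M (P (range Some)) (R (range Some))" by (rule prob_space_distr) simp
  define S where "S = {p\<in>space (P {None} \<Otimes>\<^sub>M P (range Some)).
    fst p None \<in> A \<and> (\<forall>d. snd p (Some d) < h d * fst p None)}"
  have S: "S \<in> sets (P {None} \<Otimes>\<^sub>M P (range Some))"
  proof -
    let ?N = "P {None} \<Otimes>\<^sub>M P (range Some)"
    have c0: "(\<lambda>p. fst p None) \<in> borel_measurable ?N"
      by (rule measurable_compose[OF measurable_fst comp]) simp
    have c1: "(\<lambda>p. snd p (Some d)) \<in> borel_measurable ?N" for d
      by (rule measurable_compose[OF measurable_snd comp]) simp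
    have c2: "(\<lambda>p. h d * fst p None) \<in> borel_measurable ?N" for d
      by (rule borel_measurable_times[OF borel_measurable_const c0])
    show ?thesis
      unfolding S_def
    proof (intro sets.sets_Collect_conj sets.sets_Collect_countable_All)
      show "{p \<in> space ?N. fst p None \<in> A} \<in> sets ?N"
        by (rule measurable_sets_Collect[OF c0]) simp
      show "{p \<in> space ?N. snd p (Some d) < h d * fst p None} \<in> sets ?N" for d
        by (rule borel_measurable_less[OF c1 c2, unfolded pred_def])
    qed
  qed
  have S': "S \<in> sets (distr M (P {None}) (R {None}) \<Otimes>\<^sub>M distr M (P (range Some)) (R (range Some)))"
    using S by (simp cong: sets_pair_measure_cong)
  define F where "F = (\<lambda>z. ennreal (\<Prod>d\<in>UNIV. prob {\<omega>\<in>space M. T (Some d) \<omega> < h d * z}) * indicator A z)"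
  have slice: "emeasure (distr M (P (range Some)) (R (range Some))) (Pair f -` S) = F (f None)"
    if f: "f \<in> space (P {None})" for f
  proof -
    let ?z = "f None"
    have m: "Pair f -` S \<in> sets (P (range Some))" by (rule sets_Pair1[OF S])
    have "emeasure (distr M (P (range Some)) (R (range Some))) (Pair f -` S) =
        emeasure M {\<omega>\<in>space M. ?z \<in> A \<and> (\<forall>d. T (Some d) \<omega> < h d * ?z)}"
      unfolding emeasure_distr[OF R m]
      using f measurable_space[OF R] by (auto simp: S_def space_pair_measure R_def intro!: arg_cong[where f="emeasure M"])
    also have "\<dots> = emeasure M {\<omega>\<in>space M. \<forall>d. T (Some d) \<omega> < h d * ?z} * indicator A ?z"
      by (auto simp: indicator_def)
    also have "{\<omega>\<in>space M. \<forall>d. T (Some d) \<omega> < h d * ?z} = (\<Inter>i\<in>range Some. T i -` {..<h (the i) * ?z} \<inter> space M)"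
      by auto
    also have "emeasure M \<dots> = ennreal (\<Prod>i\<in>range Some. prob (T i -` {..<h (the i) * ?z} \<inter> space M))"
      unfolding emeasure_eq_measure by (subst indep_varsD[OF ind]) auto
    also have "(\<Prod>i\<in>range Some. prob (T i -` {..<h (the i) * ?z} \<inter> space M)) =
        (\<Prod>d\<in>UNIV. prob {\<omega>\<in>space M. T (Some d) \<omega> < h d * ?z})"
      by (subst prod.reindex) (auto intro!: prod.cong arg_cong[where f=prob])
    finally show ?thesis by (simp add: F_def)
  qed
  have F[measurable]: "F \<in> borel_measurable borel"
  proof -
    have "(\<lambda>z. prob {\<omega>\<in>space M. T (Some d) \<omega> < h d * z}) \<in> borel_measurable borel" for d
      by measurable
    then show ?thesis unfolding F_def by measurable
  qed
  have "emeasure M {\<omega>\<in>space M. T None \<omega> \<in> A \<and> (\<forall>d. T (Some d) \<omega> < h d * T None \<omega>)} =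
      emeasure (distr M (P {None} \<Otimes>\<^sub>M P (range Some)) (\<lambda>\<omega>. (R {None} \<omega>, R (range Some) \<omega>))) S"
    unfolding emeasure_distr[OF measurable_Pair[OF R R] S]
    using measurable_space[OF R] by (auto simp: S_def space_pair_measure R_def intro!: arg_cong[where f="emeasure M"])
  also have "\<dots> = (\<integral>\<^sup>+f. emeasure (distr M (P (range Some)) (R (range Some))) (Pair f -` S) \<partial>distr M (P {None}) (R {None}))"
    unfolding eq[symmetric] by (rule DR.emeasure_pair_measure_alt[OF S'])
  also have "\<dots> = (\<integral>\<^sup>+f. F (f None) \<partial>distr M (P {None}) (R {None}))"
    by (intro nn_integral_cong slice) simp
  also have "\<dots> = (\<integral>\<^sup>+\<omega>. F (T None \<omega>) \<partial>M)"
    using measurable_compose[OF comp F, of None "{None}"]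
    by (subst nn_integral_distr[OF R]) (simp_all add: R_def)
  also have "\<dots> = (\<integral>\<^sup>+z. F z \<partial>distr M borel (T None))"
    by (subst nn_integral_distr) auto
  finally show ?thesis by (simp only: F_def)
qed

text \<open>Each normalised residual combines two neighbours and the centre, so a product of two of
  them costs nine second moments. The form with \<open>has_bochner_integral\<close> delivers
  integrability along with the value.\<close>

lemma integral_product3:
  fixes A B C D E F :: "'a \<Rightarrow> real"
  assumes "integrable M (\<lambda>x. A x * D x)" "integrable M (\<lambda>x. A x * E x)" "integrable M (\<lambda>x. A x * F x)"
    "integrable M (\<lambda>x. B x * D x)" "integrable M (\<lambda>x. B x * E x)" "integrable M (\<lambda>x. B x * F x)"
    "integrable M (\<lambda>x. C x * D x)" "integrable M (\<lambda>x. C x * E x)" "integrable M (\<lambda>x. C x * F x)"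
  shows "has_bochner_integral M (\<lambda>x. (a * A x + b * B x + c * C x) * (d * D x + e * E x + f * F x))
     (a * d * (LINT x|M. A x * D x) + a * e * (LINT x|M. A x * E x) + a * f * (LINT x|M. A x * F x)
    + b * d * (LINT x|M. B x * D x) + b * e * (LINT x|M. B x * E x) + b * f * (LINT x|M. B x * F x)
    + c * d * (LINT x|M. C x * D x) + c * e * (LINT x|M. C x * E x) + c * f * (LINT x|M. C x * F x))"
proof -
  have "(\<lambda>x. (a * A x + b * B x + c * C x) * (d * D x + e * E x + f * F x)) =
    (\<lambda>x. a * d * (A x * D x) + a * e * (A x * E x) + a * f * (A x * F x)
    + b * d * (B x * D x) + b * e * (B x * E x) + b * f * (B x * F x)
    + c * d * (C x * D x) + c * e * (C x * E x) + c * f * (C x * F x))"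
    by (simp add: fun_eq_iff algebra_simps)
  then show ?thesis
    using assms by (simp only:) (intro has_bochner_integral_add has_bochner_integral_mult_right has_bochner_integral_integrable)
qed

lemma sum_UNIV_option_bool:
  fixes f :: "('d::finite \<times> bool) option \<Rightarrow> real"
  shows "(\<Sum>k\<in>UNIV. f k) = f None + (\<Sum>d\<in>UNIV. f (Some (d, True)) + f (Some (d, False)))"
proof -
  have "(\<Sum>k\<in>UNIV. f k) = f None + (\<Sum>k\<in>UNIV. f (Some k))"
    unfolding UNIV_option_conv by (subst sum.insert) (auto simp: sum.reindex)
  also have "(\<Sum>k\<in>UNIV. f (Some k)) = (\<Sum>d\<in>UNIV. \<Sum>b\<in>UNIV. f (Some (d, b)))"
    by (simp add: UNIV_Times_UNIV[symmetric] sum.cartesian_product del: UNIV_Times_UNIV)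
  finally show ?thesis by (simp add: UNIV_bool add.commute)
qed

section \<open>From the centre and its neighbours to orthonormal variables\<close>

text \<open>\<open>None\<close> is the centre; \<open>Some (d, True)\<close> and
  \<open>Some (d, False)\<close> are the two opposite neighbours in direction d. The covariance
  hypotheses are those of the lattice, and they make the variables \<open>X\<close> below
  orthonormal, hence independent.\<close>

lemma (in prob_space) emeasure_peak:
  fixes Y :: "('d::finite \<times> bool) option \<Rightarrow> 'a \<Rightarrow> real" and \<rho> :: "'d \<Rightarrow> real"
  assumes gauss: "\<And>c. gaussian_rv M (\<lambda>\<omega>. \<Sum>k\<in>UNIV. c k * Y k \<omega>)"
    and int1: "\<And>k. integrable M (Y k)" and mean: "\<And>k. expectation (Y k) = 0"
    and int2: "\<And>k l. integrable M (\<lambda>\<omega>. Y k \<omega> * Y l \<omega>)"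
    and var: "\<And>k. expectation (\<lambda>\<omega>. Y k \<omega> * Y k \<omega>) = 1"
    and cov0: "\<And>d b. expectation (\<lambda>\<omega>. Y None \<omega> * Y (Some (d, b)) \<omega>) = \<rho> d"
    and cov1: "\<And>d. expectation (\<lambda>\<omega>. Y (Some (d, True)) \<omega> * Y (Some (d, False)) \<omega>) = \<rho> d ^ 4"
    and cov2: "\<And>d e b c. d \<noteq> e \<Longrightarrow> expectation (\<lambda>\<omega>. Y (Some (d, b)) \<omega> * Y (Some (e, c)) \<omega>) = \<rho> d * \<rho> e"
    and \<rho>: "\<And>d. 0 < \<rho> d" "\<And>d. \<rho> d < 1" and A: "A \<in> sets borel"
  shows "emeasure M {\<omega>\<in>space M. Y None \<omega> \<in> A \<and> (\<forall>d b. Y (Some (d, b)) \<omega> < Y None \<omega>)} =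
    (\<integral>\<^sup>+z. ennreal ((\<Prod>d\<in>UNIV. Q (\<rho> d) z) * std_normal_density z) * indicator A z \<partial>lborel)"
proof -
  have \<rho>2: "0 < (\<rho> d)\<^sup>2" "(\<rho> d)\<^sup>2 < 1" for d using \<rho>[of d] by (auto simp: abs_square_less_1)
  have cov0': "expectation (\<lambda>\<omega>. Y (Some (d, b)) \<omega> * Y None \<omega>) = \<rho> d" for d b
    using cov0[of d b] by (simp add: mult.commute)
  have cov1': "expectation (\<lambda>\<omega>. Y (Some (d, False)) \<omega> * Y (Some (d, True)) \<omega>) = \<rho> d ^ 4" for d
    using cov1[of d] by (simp add: mult.commute)
  \<comment> \<open>\<open>p\<close> and \<open>q\<close> normalise the sum of the residuals of the two neighbours in a direction, given the
    centre, and their difference; these are uncorrelated.\<close>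
  define p where "p = (\<lambda>d. 1 / (sqrt 2 * (1 - (\<rho> d)\<^sup>2)))"
  define q where "q = (\<lambda>d. 1 / (sqrt 2 * sqrt (1 - \<rho> d ^ 4)))"
  define X where "X = (\<lambda>k \<omega>. case k of None \<Rightarrow> Y None \<omega>
    | Some (d, True) \<Rightarrow> p d * Y (Some (d, True)) \<omega> + p d * Y (Some (d, False)) \<omega> + (- 2 * \<rho> d * p d) * Y None \<omega>
    | Some (d, False) \<Rightarrow> q d * Y (Some (d, True)) \<omega> + (- q d) * Y (Some (d, False)) \<omega> + 0 * Y None \<omega>)"
  \<comment> \<open>Zero coefficients pad all three kinds of variable to the shape of
    \<open>integral_product3\<close>.\<close>
  have X_simps: "X None = (\<lambda>\<omega>. 0 * Y None \<omega> + 0 * Y None \<omega> + 1 * Y None \<omega>)"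
    "X (Some (d, True)) = (\<lambda>\<omega>. p d * Y (Some (d, True)) \<omega> + p d * Y (Some (d, False)) \<omega> + (- 2 * \<rho> d * p d) * Y None \<omega>)"
    "X (Some (d, False)) = (\<lambda>\<omega>. q d * Y (Some (d, True)) \<omega> + (- q d) * Y (Some (d, False)) \<omega> + 0 * Y None \<omega>)" for d
    by (simp_all add: X_def)
  \<comment> \<open>The bracket is the variance of the sum of the two residuals, 2 (1 - \<rho>^2) +
    2 (\<rho>^4 - \<rho>^2), a perfect square up to the factor 2.\<close>
  have p1: "p d * p d * (2 - 4 * (\<rho> d)\<^sup>2 + 2 * \<rho> d ^ 4) = 1" for d
  proof -
    have "2 - 4 * (\<rho> d)\<^sup>2 + 2 * \<rho> d ^ 4 = 2 * (1 - (\<rho> d)\<^sup>2)\<^sup>2" by algebra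
    moreover have "p d * p d = 1 / (2 * (1 - (\<rho> d)\<^sup>2)\<^sup>2)"
      by (simp only: power2_eq_square[symmetric] p_def power_divide power_mult_distrib) simp
    ultimately show ?thesis using \<rho>2[of d] by simp
  qed
  \<comment> \<open>In the difference of the residuals the centre cancels, which leaves variance 2 -
    2 \<rho>^4.\<close>
  have q1: "q d * q d * (2 - 2 * \<rho> d ^ 4) = 1" for d
  proof -
    have "\<rho> d ^ 4 < 1" using \<rho>[of d] by (simp add: power_less_one_iff)
    moreover have "q d * q d = 1 / (2 * (1 - \<rho> d ^ 4))"
      using \<open>\<rho> d ^ 4 < 1\<close> by (simp only: power2_eq_square[symmetric] q_def power_divide power_mult_distrib) simp
    ultimately show ?thesis by simp
  qed
  have bil: "has_bochner_integral M (\<lambda>\<omega>. X i \<omega> * X j \<omega>) (if i = j then 1 else 0)" for i j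
  proof -
    have P3: "has_bochner_integral M (\<lambda>\<omega>. X i \<omega> * X j \<omega>) w"
      if "X i = (\<lambda>\<omega>. a * Y k1 \<omega> + b * Y k2 \<omega> + c * Y k3 \<omega>)" "X j = (\<lambda>\<omega>. d * Y l1 \<omega> + e * Y l2 \<omega> + f * Y l3 \<omega>)"
       "a * d * expectation (\<lambda>x. Y k1 x * Y l1 x) + a * e * expectation (\<lambda>x. Y k1 x * Y l2 x) + a * f * expectation (\<lambda>x. Y k1 x * Y l3 x)
    + b * d * expectation (\<lambda>x. Y k2 x * Y l1 x) + b * e * expectation (\<lambda>x. Y k2 x * Y l2 x) + b * f * expectation (\<lambda>x. Y k2 x * Y l3 x)
    + c * d * expectation (\<lambda>x. Y k3 x * Y l1 x) + c * e * expectation (\<lambda>x. Y k3 x * Y l2 x) + c * f * expectation (\<lambda>x. Y k3 x * Y l3 x) = w"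
      for i j a b c d e f k1 k2 k3 l1 l2 l3 w
      using integral_product3[OF int2 int2 int2 int2 int2 int2 int2 int2 int2, of a k1 b k2 c k3 d l1 e l2 f l3]
      unfolding that .
    note cov = var cov0 cov0' cov1 cov1' cov2
    have 1: "has_bochner_integral M (\<lambda>\<omega>. X None \<omega> * X None \<omega>) 1"
      by (rule P3[OF X_simps(1) X_simps(1)]) (simp add: cov)
    have 2: "has_bochner_integral M (\<lambda>\<omega>. X None \<omega> * X (Some (d, True)) \<omega>) 0" for d
      by (rule P3[OF X_simps(1) X_simps(2)]) (simp add: cov)
    have 3: "has_bochner_integral M (\<lambda>\<omega>. X None \<omega> * X (Some (d, False)) \<omega>) 0" for d
      by (rule P3[OF X_simps(1) X_simps(3)]) (simp add: cov)
    have 4: "has_bochner_integral M (\<lambda>\<omega>. X (Some (d, True)) \<omega> * X (Some (d, True)) \<omega>) 1" for d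
      by (rule P3[OF X_simps(2) X_simps(2)])
        (use p1[of d] in \<open>simp add: cov algebra_simps power2_eq_square\<close>)
    have 5: "has_bochner_integral M (\<lambda>\<omega>. X (Some (d, False)) \<omega> * X (Some (d, False)) \<omega>) 1" for d
      by (rule P3[OF X_simps(3) X_simps(3)])
        (use q1[of d] in \<open>simp add: cov algebra_simps power2_eq_square\<close>)
    \<comment> \<open>The two opposite neighbours in direction e have the same total covariance with
      the symmetric sum, so their difference is orthogonal to it, also for d = e.\<close>
    have 6: "has_bochner_integral M (\<lambda>\<omega>. X (Some (d, True)) \<omega> * X (Some (e, False)) \<omega>) 0" for d e
      by (rule P3[OF X_simps(2) X_simps(3)]; cases "d = e") (simp_all add: cov algebra_simps)
    have 7: "has_bochner_integral M (\<lambda>\<omega>. X (Some (d, True)) \<omega> * X (Some (e, True)) \<omega>) 0" if "d \<noteq> e" for d e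
      by (rule P3[OF X_simps(2) X_simps(2)]) (use that in \<open>simp add: cov algebra_simps\<close>)
    have 8: "has_bochner_integral M (\<lambda>\<omega>. X (Some (d, False)) \<omega> * X (Some (e, False)) \<omega>) 0" if "d \<noteq> e" for d e
      by (rule P3[OF X_simps(3) X_simps(3)]) (use that in \<open>simp add: cov algebra_simps\<close>)
    have 9: "has_bochner_integral M (\<lambda>\<omega>. X k \<omega> * X None \<omega>) (if k = None then 1 else 0)" for k
    proof (cases k)
      case None
      then show ?thesis using 1 by simp
    next
      case (Some k')
      obtain d b where "k = Some (d, b)" using Some by (cases k') auto
      then show ?thesis using 2[of d] 3[of d] by (cases b) (auto simp: mult.commute)
    qed
    have 10: "has_bochner_integral M (\<lambda>\<omega>. X (Some (e, False)) \<omega> * X (Some (d, True)) \<omega>) 0" for d e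
      using 6[of d e] by (simp add: mult.commute)
    show ?thesis
    proof (cases j)
      case None
      then show ?thesis using 9[of i] by simp
    next
      case (Some j')
      obtain e c where j: "j = Some (e, c)" using Some by (cases j') auto
      show ?thesis
      proof (cases i)
        case None
        then show ?thesis using 2[of e] 3[of e] j by (cases c) auto
      next
        case (Some i')
        obtain d b where "i = Some (d, b)" using Some by (cases i') auto
        then show ?thesis using 4[of d] 5[of d] 6[of d e] 7[of d e] 8[of d e] 10[of d e] j
          by (cases b; cases c; cases "d = e") auto
      qed
    qed
  qed
  have Xint: "integrable M (X k)" and Xmean: "expectation (X k) = 0" for k
  proof -
    obtain a k1 b k2 c k3 where "X k = (\<lambda>\<omega>. a * Y k1 \<omega> + b * Y k2 \<omega> + c * Y k3 \<omega>)"
    proof (cases k)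
      case None
      then show ?thesis using X_simps(1) that by blast
    next
      case (Some k')
      obtain d b where k: "k = Some (d, b)" using Some by (cases k') auto
      show ?thesis
      proof (cases b)
        case True
        then show ?thesis using X_simps(2)[of d] k by (intro that) (simp only:)
      next
        case False
        then show ?thesis using X_simps(3)[of d] k by (intro that) (simp only:)
      qed
    qed
    then show "integrable M (X k)" "expectation (X k) = 0"
      using int1 mean by auto
  qed
  have Xg: "gaussian_rv M (\<lambda>\<omega>. \<Sum>k\<in>UNIV. a k * X k \<omega>)" for a
  proof -
    \<comment> \<open>Combinations of \<open>X\<close> are rewritten as combinations of
      \<open>Y\<close>; the coefficient of the centre collects a contribution from every
      direction.\<close>
    define c where "c = (\<lambda>k. case k of None \<Rightarrow> a None - (\<Sum>d\<in>UNIV. a (Some (d, True)) * (2 * \<rho> d * p d))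
      | Some (d, True) \<Rightarrow> a (Some (d, True)) * p d + a (Some (d, False)) * q d
      | Some (d, False) \<Rightarrow> a (Some (d, True)) * p d - a (Some (d, False)) * q d)"
    have "(\<Sum>k\<in>UNIV. a k * X k \<omega>) = (\<Sum>k\<in>UNIV. c k * Y k \<omega>)" for \<omega>
      unfolding sum_UNIV_option_bool
      by (simp add: X_simps c_def algebra_simps sum.distrib sum_subtractf sum_negf sum_distrib_left sum_distrib_right)
    then show ?thesis using gauss[of c] by simp
  qed
  have ind: "indep_vars (\<lambda>_. borel) X UNIV" and std: "distributed M lborel (X k) std_normal_density" for k
    using gaussian_orthonormal_iid[of UNIV X] Xint Xmean Xg bil
    by (auto simp: has_bochner_integral_iff)
  \<comment> \<open>\<open>T (Some d)\<close> is the larger of the two standardised residuals in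
    direction d, since the two square roots are sin \<alpha> and cos \<alpha>.\<close>
  define T where "T = (\<lambda>k \<omega>. case k of None \<Rightarrow> X None \<omega> | Some d \<Rightarrow>
     sqrt ((1 - (\<rho> d)\<^sup>2) / 2) * X (Some (d, True)) \<omega> + sqrt ((1 + (\<rho> d)\<^sup>2) / 2) * \<bar>X (Some (d, False)) \<omega>\<bar>)"
  have indT: "indep_vars (\<lambda>_. borel) T UNIV"
  proof -
    \<comment> \<open>The sets \<open>J k\<close> are disjoint blocks of indices, so functions of
      the blocks inherit independence from \<open>X\<close>.\<close>
    define J where "J = (\<lambda>k :: 'd option. case k of None \<Rightarrow> {None} | Some d \<Rightarrow> {Some (d, True), Some (d, False)})"
    define f where "f = (\<lambda>k g. case k of None \<Rightarrow> g None | Some d \<Rightarrow>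
      sqrt ((1 - (\<rho> d)\<^sup>2) / 2) * g (Some (d, True)) + sqrt ((1 + (\<rho> d)\<^sup>2) / 2) * \<bar>g (Some (d, False))\<bar>)"
    have "indep_vars (\<lambda>k. PiM (J k) (\<lambda>_. borel)) (\<lambda>k \<omega>. restrict (\<lambda>i. X i \<omega>) (J k)) UNIV"
      by (rule indep_vars_restrict[OF ind]) (auto simp: J_def disjoint_family_on_def split: option.splits)
    then have "indep_vars (\<lambda>_. borel) (\<lambda>k \<omega>. f k (restrict (\<lambda>i. X i \<omega>) (J k))) UNIV"
    proof (rule indep_vars_compose2)
      show "f k \<in> borel_measurable (PiM (J k) (\<lambda>_. borel))" for k
        unfolding f_def J_def by (cases k) auto
    qed
    also have "(\<lambda>k \<omega>. f k (restrict (\<lambda>i. X i \<omega>) (J k))) = T"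
      by (auto simp: fun_eq_iff f_def J_def T_def split: option.splits)
    finally show ?thesis .
  qed
  have QT: "prob {\<omega>\<in>space M. T (Some d) \<omega> < h_coef (\<rho> d) * z} = Q (\<rho> d) z" for d z
  proof -
    have "indep_var borel (X (Some (d, True))) borel (X (Some (d, False)))"
    proof -
      have "indep_var (PiM {Some (d, True)} (\<lambda>_. borel)) (\<lambda>\<omega>. restrict (\<lambda>i. X i \<omega>) {Some (d, True)})
          (PiM {Some (d, False)} (\<lambda>_. borel)) (\<lambda>\<omega>. restrict (\<lambda>i. X i \<omega>) {Some (d, False)})"
        by (rule indep_var_restrict[OF ind]) auto
      from indep_var_compose[OF this, of "\<lambda>f. f (Some (d, True))" borel "\<lambda>f. f (Some (d, False))" borel]
      show ?thesis by (simp add: comp_def)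
    qed
    from Q_eq_prob[OF \<rho> std std this] show ?thesis
      by (simp add: T_def)
  qed
  have ev: "(\<forall>b. Y (Some (d, b)) \<omega> < Y None \<omega>) \<longleftrightarrow> T (Some d) \<omega> < h_coef (\<rho> d) * T None \<omega>" for d \<omega>
  proof -
    define t where "t = sqrt (1 - (\<rho> d)\<^sup>2)"
    have t: "0 < t" "t * t = 1 - (\<rho> d)\<^sup>2" using \<rho>2[of d] by (auto simp: t_def)
    have e1: "sqrt ((1 - (\<rho> d)\<^sup>2) / 2) * p d = 1 / (2 * t)"
      unfolding p_def t(2)[symmetric] using t(1) by (simp add: real_sqrt_divide field_simps)
    define u where "u = sqrt (1 + (\<rho> d)\<^sup>2)"
    have u: "0 < u" by (simp add: u_def add_pos_nonneg)
    have "1 - \<rho> d ^ 4 = (1 - (\<rho> d)\<^sup>2) * (1 + (\<rho> d)\<^sup>2)" by algebra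
    then have "sqrt (1 - \<rho> d ^ 4) = t * u"
      by (simp only: real_sqrt_mult t_def u_def)
    then have "q d = 1 / (sqrt 2 * (t * u))" by (simp only: q_def)
    moreover have "sqrt ((1 + (\<rho> d)\<^sup>2) / 2) = u / sqrt 2"
      by (simp only: real_sqrt_divide u_def)
    ultimately have "sqrt ((1 + (\<rho> d)\<^sup>2) / 2) * q d = (u / sqrt 2) * (1 / (sqrt 2 * (t * u)))" by simp
    also have "\<dots> = 1 / (2 * t)"
      using u t(1) by (simp add: field_simps)
    finally have e2: "sqrt ((1 + (\<rho> d)\<^sup>2) / 2) * q d = 1 / (2 * t)" .
    \<comment> \<open>Expanding the fraction by 1 - \<rho> shows that h is the standardised gap 1 -
      \<rho> between the centre value and the mean it predicts.\<close>
    have e3: "h_coef (\<rho> d) = (1 - \<rho> d) / t"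
    proof -
      define x y where "x = sqrt (1 - \<rho> d)" and "y = sqrt (1 + \<rho> d)"
      have xy: "0 < x" "0 < y" "x * x = 1 - \<rho> d" using \<rho>[of d] by (auto simp: x_def y_def)
      have "1 - (\<rho> d)\<^sup>2 = (1 - \<rho> d) * (1 + \<rho> d)" by algebra
      then have "t = x * y" by (simp only: t_def x_def y_def real_sqrt_mult)
      moreover have "h_coef (\<rho> d) = x / y" by (simp only: h_coef_def real_sqrt_divide x_def y_def)
      ultimately have "h_coef (\<rho> d) = (x * x) / t" using xy(1,2) by simp
      then show ?thesis by (simp only: xy(3))
    qed
    let ?A = "Y (Some (d, True)) \<omega>" and ?B = "Y (Some (d, False)) \<omega>" and ?C = "Y None \<omega>"
    have q0: "0 \<le> sqrt ((1 + (\<rho> d)\<^sup>2) / 2)" by simp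
    have "T (Some d) \<omega> = (sqrt ((1 - (\<rho> d)\<^sup>2) / 2) * p d) * (?A + ?B - 2 * \<rho> d * ?C) +
        \<bar>(sqrt ((1 + (\<rho> d)\<^sup>2) / 2) * q d) * (?A - ?B)\<bar>"
      unfolding T_def X_simps option.case abs_mult abs_of_nonneg[OF q0] by (simp add: algebra_simps abs_mult[symmetric])
    also have "\<dots> = (?A + ?B - 2 * \<rho> d * ?C + \<bar>?A - ?B\<bar>) / (2 * t)"
      unfolding e1 e2 using t(1) by (simp add: abs_mult add_divide_distrib)
    finally have T1: "T (Some d) \<omega> = (?A + ?B - 2 * \<rho> d * ?C + \<bar>?A - ?B\<bar>) / (2 * t)" .
    have T2: "h_coef (\<rho> d) * T None \<omega> = (2 * (1 - \<rho> d) * ?C) / (2 * t)"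
      unfolding e3 using t(1) by (simp add: T_def X_def field_simps)
    have "T (Some d) \<omega> < h_coef (\<rho> d) * T None \<omega> \<longleftrightarrow>
        (?A + ?B - 2 * \<rho> d * ?C + \<bar>?A - ?B\<bar>) / (2 * t) < (2 * (1 - \<rho> d) * ?C) / (2 * t)"
      unfolding T1 T2 ..
    also have "\<dots> \<longleftrightarrow> ?A + ?B - 2 * \<rho> d * ?C + \<bar>?A - ?B\<bar> < 2 * (1 - \<rho> d) * ?C"
      using t(1) by (simp only: divide_less_cancel) simp
    \<comment> \<open>The terms in \<rho> cancel, and ?A + ?B + \<bar>?A - ?B\<bar> is twice the
      maximum of the two neighbours.\<close>
    also have "\<dots> \<longleftrightarrow> ?A + ?B + \<bar>?A - ?B\<bar> < 2 * ?C"
      by (simp add: algebra_simps)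
    also have "\<dots> \<longleftrightarrow> ?A < ?C \<and> ?B < ?C"
      by auto
    also have "\<dots> \<longleftrightarrow> (\<forall>b. Y (Some (d, b)) \<omega> < Y None \<omega>)"
      by (auto simp: all_bool_eq)
    finally show ?thesis ..
  qed
  have "emeasure M {\<omega>\<in>space M. Y None \<omega> \<in> A \<and> (\<forall>d b. Y (Some (d, b)) \<omega> < Y None \<omega>)} =
      emeasure M {\<omega>\<in>space M. T None \<omega> \<in> A \<and> (\<forall>d. T (Some d) \<omega> < h_coef (\<rho> d) * T None \<omega>)}"
    unfolding ev by (simp add: T_def X_simps)
  also have "\<dots> = (\<integral>\<^sup>+z. ennreal (\<Prod>d\<in>UNIV. Q (\<rho> d) z) * indicator A z \<partial>distr M borel (T None))"
    using emeasure_indep_random_threshold[OF indT A, of "\<lambda>d. h_coef (\<rho> d)"] unfolding QT .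
  also have "distr M borel (T None) = density lborel std_normal_density"
  proof -
    have "distr M borel (T None) = distr M lborel (X None)"
      by (rule distr_cong) (auto simp: T_def)
    then show ?thesis using distributed_distr_eq_density[OF std[of None]] by simp
  qed
  also have "(\<integral>\<^sup>+z. ennreal (\<Prod>d\<in>UNIV. Q (\<rho> d) z) * indicator A z \<partial>density lborel std_normal_density) =
      (\<integral>\<^sup>+z. ennreal ((\<Prod>d\<in>UNIV. Q (\<rho> d) z) * std_normal_density z) * indicator A z \<partial>lborel)"
    using A by (subst nn_integral_density) (auto intro!: nn_integral_cong
        simp: ennreal_mult'[OF normal_density_nonneg] ennreal_mult''[OF normal_density_nonneg] mult_ac)
  finally show ?thesis .
qed

section \<open>Correlations between lattice sites\<close>

lemma spatial_corr_eq:
  "spatial_corr \<eta> t t' = exp (- (1/2) * (\<Sum>i\<in>UNIV. ((t - t') $ i)\<^sup>2 / (2 * (\<eta> $ i)\<^sup>2)))"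
proof -
  have "(x \<bullet> (Lambda \<eta> *v x)) = (\<Sum>i\<in>UNIV. (x $ i)\<^sup>2 / (2 * (\<eta> $ i)\<^sup>2))" for x
    by (simp add: inner_vec_def matrix_vector_mult_def Lambda_def if_distrib[of "\<lambda>c. c * _"] power2_eq_square
        cong: if_cong)
  then show ?thesis by (simp add: spatial_corr_def)
qed

lemma spatial_corr_same_axis:
  "spatial_corr \<eta> (s + a *\<^sub>R axis d 1) (s + b *\<^sub>R axis d 1) = exp (- (1/2) * ((a - b)\<^sup>2 / (2 * (\<eta> $ d)\<^sup>2)))"
proof -
  have "((s + a *\<^sub>R axis d 1) - (s + b *\<^sub>R axis d 1)) $ i = (if i = d then a - b else 0)" for i
    by (simp add: axis_def)
  then show ?thesis unfolding spatial_corr_eq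
    by (simp add: if_distrib[of "\<lambda>x. x\<^sup>2"] if_distrib[of "\<lambda>x. x / _"] cong: if_cong)
qed

text \<open>As \<open>Lambda\<close> is diagonal, the squared lengths along two axes add up in the
  exponent and the kernel factors. This product form is the source of the conditional independence
  of different directions.\<close>

lemma spatial_corr_distinct_axes:
  assumes "d \<noteq> e"
  shows "spatial_corr \<eta> (s + a *\<^sub>R axis d 1) (s + b *\<^sub>R axis e 1) =
    exp (- (1/2) * (a\<^sup>2 / (2 * (\<eta> $ d)\<^sup>2))) * exp (- (1/2) * (b\<^sup>2 / (2 * (\<eta> $ e)\<^sup>2)))"
proof -
  have *: "(((s + a *\<^sub>R axis d 1) - (s + b *\<^sub>R axis e 1)) $ i)\<^sup>2 / (2 * (\<eta> $ i)\<^sup>2) =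
      (if i = d then a\<^sup>2 / (2 * (\<eta> $ d)\<^sup>2) else 0) + (if i = e then b\<^sup>2 / (2 * (\<eta> $ e)\<^sup>2) else 0)" for i
    using assms by (simp add: axis_def)
  show ?thesis unfolding spatial_corr_eq * sum.distrib mult_exp_exp
    by (simp add: distrib_left)
qed

lemma integrable_mult_of_square_integrable:
  fixes X Y :: "'a \<Rightarrow> real"
  assumes [measurable]: "X \<in> borel_measurable M" "Y \<in> borel_measurable M"
    and "integrable M (\<lambda>x. X x * X x)" "integrable M (\<lambda>x. Y x * Y x)"
  shows "integrable M (\<lambda>x. X x * Y x)"
proof (rule Bochner_Integration.integrable_bound[OF Bochner_Integration.integrable_add[OF assms(3,4)]])
  have "\<bar>x * y\<bar> \<le> \<bar>x * x + y * y\<bar>" for x y :: real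
  proof -
    have "2 * \<bar>x * y\<bar> \<le> x * x + y * y"
      using sum_squares_bound[of "\<bar>x\<bar>" "\<bar>y\<bar>"] by (simp add: abs_mult power2_eq_square)
    then show ?thesis by linarith
  qed
  then show "AE x in M. norm (X x * Y x) \<le> norm (X x * X x + Y x * Y x)" by simp
qed simp

text \<open>The right-hand side is written for a standard normal centre, which is why mean 0 and
  variance 1 are fixed. The law of the peak height is expressed as the law of \<open>Z s\<close>
  under the measure conditioned on the peak event.\<close>

theorem proposition2:
  fixes M :: "'w measure"
    and v \<eta> s :: "real^'d"
    and L :: "(real^'d) set"
    and Z :: "real^'d \<Rightarrow> 'w \<Rightarrow> real"
  assumes "\<And>d. 0 < v $ d"
    and "\<And>d. 0 < \<eta> $ d"
    and "L \<subseteq> lattice_sites v"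
    and "stationary_gaussian_field M L Z"
    and "\<And>t. t \<in> L \<Longrightarrow> expect M (Z t) = 0"
    and "\<And>t. t \<in> L \<Longrightarrow> covariance M (Z t) (Z t) = 1"
    and "\<And>t t'. t \<in> L \<Longrightarrow> t' \<in> L \<Longrightarrow> correlation M (Z t) (Z t') = spatial_corr \<eta> t t'"
    and "s \<in> L"
    and "N_PC v s \<subseteq> L"
  shows "(\<forall>u::real.
            \<P>(\<omega> in M. u < Z s \<omega> \<bar> \<forall>t\<in>N_PC v s. Z t \<omega> < Z s \<omega>) =
            (LBINT z:{u<..}. (\<Prod>d\<in>UNIV. Q (rho_dir v \<eta> s d) z) * std_normal_density z) /
            (LBINT z. (\<Prod>d\<in>UNIV. Q (rho_dir v \<eta> s d) z) * std_normal_density z)) \<and>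
         distributed (uniform_measure M {\<omega> \<in> space M. \<forall>t\<in>N_PC v s. Z t \<omega> < Z s \<omega>}) lborel (Z s)
           (\<lambda>z. ennreal ((\<Prod>d\<in>UNIV. Q (rho_dir v \<eta> s d) z) * std_normal_density z /
                    (LBINT z. (\<Prod>d\<in>UNIV. Q (rho_dir v \<eta> s d) z) * std_normal_density z)))"
proof -
  have field: "gaussian_field M L Z" using assms(4) by (simp add: stationary_gaussian_field_def)
  then interpret prob_space M by (simp add: gaussian_field_def)
  have Zm[measurable]: "Z t \<in> borel_measurable M" if "t \<in> L" for t
    using gaussian_field_sum[OF field, of "{()}" "\<lambda>_. t" "\<lambda>_. 1"] that by (simp add: gaussian_rv_def)
  have mean: "expectation (Z t) = 0" if "t \<in> L" for t
    using assms(5)[OF that] by (simp add: expect_def)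
  have cov: "covariance M (Z t) (Z t') = expectation (\<lambda>\<omega>. Z t \<omega> * Z t' \<omega>)" if "t \<in> L" "t' \<in> L" for t t'
    using that assms(5) by (simp add: covariance_def) (simp add: expect_def)
  have var: "expectation (\<lambda>\<omega>. Z t \<omega> * Z t \<omega>) = 1" if "t \<in> L" for t
    using assms(6)[OF that] cov[OF that that] by simp
  \<comment> \<open>Unit variances make the denominator of the correlation 1, so moments can be read
    off from the kernel.\<close>
  have corr: "expectation (\<lambda>\<omega>. Z t \<omega> * Z t' \<omega>) = spatial_corr \<eta> t t'" if "t \<in> L" "t' \<in> L" for t t'
    using assms(7)[OF that] assms(6) that cov[OF that] by (simp add: correlation_def)
  \<comment> \<open>A nonintegrable function has integral 0 by default, so a second moment equal to
    1 forces integrability.\<close>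
  have sq: "integrable M (\<lambda>\<omega>. Z t \<omega> * Z t \<omega>)" if "t \<in> L" for t
    using var[OF that] not_integrable_integral_eq[of M "\<lambda>\<omega>. Z t \<omega> * Z t \<omega>"] by fastforce
  define g where "g = (\<lambda>k. s + (case k of None \<Rightarrow> 0 | Some (d, b) \<Rightarrow> (if b then v $ d else - v $ d) *\<^sub>R axis d 1))"
  have g_simps: "g None = s" "g (Some (d, b)) = s + (if b then v $ d else - v $ d) *\<^sub>R axis d 1" for d b
    by (simp_all add: g_def)
  have N: "N_PC v s = range (\<lambda>k. g (Some k))"
  proof (intro equalityI subsetI)
    fix t assume "t \<in> N_PC v s"
    then obtain k d where k: "k \<in> {-1, 1 :: real}" and t: "t = s + (k * v $ d) *\<^sub>R axis d 1"
      by (auto simp: N_PC_def)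
    then have "t = g (Some (d, k = 1))" by (auto simp: g_simps)
    then show "t \<in> range (\<lambda>k. g (Some k))" by blast
  next
    fix t assume "t \<in> range (\<lambda>k. g (Some k))"
    then obtain d b where "t = g (Some (d, b))" by auto
    then have "t = s + ((if b then 1 else -1) * v $ d) *\<^sub>R axis d 1" by (simp add: g_simps)
    moreover have "(if b then 1 else -1 :: real) \<in> {-1, 1}" by simp
    ultimately show "t \<in> N_PC v s" unfolding N_PC_def by blast
  qed
  have gL: "g k \<in> L" for k
    using assms(8,9) unfolding N by (cases k) (auto simp: g_simps(1))
  define \<rho> where "\<rho> = rho_dir v \<eta> s"
  have \<rho>_eq: "\<rho> d = exp (- (1/2) * ((v $ d)\<^sup>2 / (2 * (\<eta> $ d)\<^sup>2)))" for d
    using spatial_corr_same_axis[of \<eta> s 0 d "v $ d"] by (simp add: \<rho>_def rho_dir_def)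
  have \<rho>: "0 < \<rho> d" "\<rho> d < 1" for d
    using assms(1)[of d] assms(2)[of d] by (auto simp: \<rho>_eq)
  define f where "f = (\<lambda>z. (\<Prod>d\<in>UNIV. Q (\<rho> d) z) * std_normal_density z)"
  have f_pos: "0 < f z" for z
    unfolding f_def by (intro mult_pos_pos prod_pos Q_pos \<rho> normal_density_pos) simp
  have [measurable]: "f \<in> borel_measurable borel" unfolding f_def by measurable
  define B where "B = {\<omega>\<in>space M. \<forall>t\<in>N_PC v s. Z t \<omega> < Z s \<omega>}"
  have B_alt: "B = {\<omega>\<in>space M. \<forall>d b. Z (g (Some (d, b))) \<omega> < Z (g None) \<omega>}"
    unfolding B_def N by (auto simp: g_simps(1))
  have peak: "emeasure M {\<omega>\<in>space M. Z s \<omega> \<in> A \<and> \<omega> \<in> B} = (\<integral>\<^sup>+z. ennreal (f z) * indicator A z \<partial>lborel)"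
    if A: "A \<in> sets borel" for A
  proof -
    have "emeasure M {\<omega>\<in>space M. Z (g None) \<omega> \<in> A \<and> (\<forall>d b. Z (g (Some (d, b))) \<omega> < Z (g None) \<omega>)} =
        (\<integral>\<^sup>+z. ennreal (f z) * indicator A z \<partial>lborel)"
      unfolding f_def
    proof (rule emeasure_peak[OF _ _ _ _ _ _ _ _ \<rho> A, of "\<lambda>k. Z (g k)"])
      show "gaussian_rv M (\<lambda>\<omega>. \<Sum>k\<in>UNIV. c k * Z (g k) \<omega>)" for c
        by (rule gaussian_field_sum[OF field]) (use gL in auto)
      show "integrable M (Z (g k))" for k
        \<comment> \<open>The constant 1 as one of the two factors derives the first moment from the
          second.\<close>
        using integrable_mult_of_square_integrable[OF Zm[OF gL[of k]] borel_measurable_const sq[OF gL], of 1] by simp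
      show "integrable M (\<lambda>\<omega>. Z (g k) \<omega> * Z (g l) \<omega>)" for k l
        by (rule integrable_mult_of_square_integrable[OF Zm[OF gL] Zm[OF gL] sq[OF gL] sq[OF gL]])
      show "expectation (\<lambda>\<omega>. Z (g None) \<omega> * Z (g (Some (d, b))) \<omega>) = \<rho> d" for d b
        using spatial_corr_same_axis[of \<eta> s 0 d "if b then v $ d else - v $ d"]
        unfolding corr[OF gL gL] unfolding g_simps \<rho>_eq by (cases b) simp_all
      \<comment> \<open>The displacement 2 v_d multiplies the exponent by 4, hence the fourth power
        of \<rho>.\<close>
      show "expectation (\<lambda>\<omega>. Z (g (Some (d, True))) \<omega> * Z (g (Some (d, False))) \<omega>) = \<rho> d ^ 4" for d
        unfolding corr[OF gL gL] unfolding g_simps spatial_corr_same_axis \<rho>_eq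
        by (simp add: exp_of_nat_mult[symmetric] power2_eq_square)
      show "expectation (\<lambda>\<omega>. Z (g (Some (d, b))) \<omega> * Z (g (Some (e, c))) \<omega>) = \<rho> d * \<rho> e" if "d \<noteq> e" for d e b c
        unfolding corr[OF gL gL] unfolding g_simps spatial_corr_distinct_axes[OF that] \<rho>_eq by simp
    qed (use mean var gL in auto)
    then show ?thesis
      by (simp add: B_alt g_simps(1) conj_ac cong: conj_cong)
  qed
  have Zs[measurable]: "Z s \<in> borel_measurable M" using Zm assms(8) .
  have ZN[measurable]: "Z (g k) \<in> borel_measurable M" for k using Zm gL .
  have B[measurable]: "B \<in> events" unfolding B_alt by measurable
  define c where "c = (LBINT z. f z)"
  \<comment> \<open>The choice \<open>A = UNIV\<close> shows that the total mass of \<open>f\<close>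
    is the probability of a peak, hence finite; this yields integrability of
    \<open>f\<close>.\<close>
  have B_nn: "emeasure M B = (\<integral>\<^sup>+z. ennreal (f z) \<partial>lborel)"
    using peak[of UNIV] sets.sets_into_space[OF B] by (simp add: Int_absorb1 Collect_conj_eq)
  have f_int: "integrable lborel f"
    by (rule integrableI_nonneg) (use f_pos B_nn in \<open>auto simp: less_imp_le emeasure_eq_measure intro!: AE_I2 simp flip: B_nn\<close>)
  \<comment> \<open>Positivity of the peak probability makes both the quotient and the conditioned
    measure meaningful rather than default values.\<close>
  have c_pos: "0 < c" unfolding c_def
    by (rule integral_pos_of_pos_on[OF f_int, of UNIV]) (use f_pos in \<open>auto intro: less_imp_le\<close>)
  have PB: "emeasure M B = ennreal c"
    unfolding B_nn c_def using f_int f_pos by (intro nn_integral_eq_integral) (auto intro: less_imp_le)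
  have cond: "\<P>(\<omega> in M. u < Z s \<omega> \<bar> \<forall>t\<in>N_PC v s. Z t \<omega> < Z s \<omega>) = (LBINT z:{u<..}. f z) / c" for u
  proof -
    have "emeasure M {\<omega>\<in>space M. u < Z s \<omega> \<and> (\<forall>t\<in>N_PC v s. Z t \<omega> < Z s \<omega>)} =
        emeasure M {\<omega>\<in>space M. Z s \<omega> \<in> {u<..} \<and> \<omega> \<in> B}"
      by (intro arg_cong[where f="emeasure M"]) (auto simp: B_def)
    also have "\<dots> = (\<integral>\<^sup>+z. ennreal (indicator {u<..} z * f z) \<partial>lborel)"
      by (subst peak) (auto intro!: nn_integral_cong simp: indicator_def)
    also have "\<dots> = ennreal (LBINT z:{u<..}. f z)"
    proof -
      have "integrable lborel (\<lambda>z. indicator {u<..} z * f z)"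
        using integrable_mult_indicator[OF _ f_int, of "{u<..}"] by simp
      then show ?thesis
        unfolding set_lebesgue_integral_def real_scaleR_def
        by (intro nn_integral_eq_integral) (use f_pos in \<open>auto intro: less_imp_le simp: indicator_def\<close>)
    qed
    finally have "prob {\<omega>\<in>space M. u < Z s \<omega> \<and> (\<forall>t\<in>N_PC v s. Z t \<omega> < Z s \<omega>)} = (LBINT z:{u<..}. f z)"
      unfolding measure_def using f_pos
      by (simp add: set_lebesgue_integral_def less_imp_le)
    moreover have "prob B = c" using PB c_pos by (simp add: measure_def)
    ultimately show ?thesis by (simp add: cond_prob_def B_def[symmetric])
  qed
  have "distr (uniform_measure M B) lborel (Z s) = density lborel (\<lambda>z. ennreal (f z / c))"
  proof (rule measure_eqI)
    fix A assume "A \<in> sets (distr (uniform_measure M B) lborel (Z s))"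
    then have A: "A \<in> sets borel" by simp
    have "emeasure (distr (uniform_measure M B) lborel (Z s)) A = emeasure (uniform_measure M B) (Z s -` A \<inter> space M)"
      using A by (subst emeasure_distr) auto
    also have "\<dots> = emeasure M (B \<inter> (Z s -` A \<inter> space M)) / emeasure M B"
      using A by (intro emeasure_uniform_measure) auto
    also have "B \<inter> (Z s -` A \<inter> space M) = {\<omega>\<in>space M. Z s \<omega> \<in> A \<and> \<omega> \<in> B}" by auto
    also have "emeasure M \<dots> / emeasure M B = (\<integral>\<^sup>+z. ennreal (f z) * indicator A z / ennreal c \<partial>lborel)"
      unfolding peak[OF A] PB using A by (subst nn_integral_divide) auto
    also have "\<dots> = (\<integral>\<^sup>+z. ennreal (f z / c) * indicator A z \<partial>lborel)"
      by (intro nn_integral_cong) (use f_pos c_pos in \<open>auto simp: indicator_def divide_ennreal less_imp_le\<close>)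
    also have "\<dots> = emeasure (density lborel (\<lambda>z. ennreal (f z / c))) A"
      using A by (subst emeasure_density) auto
    finally show "emeasure (distr (uniform_measure M B) lborel (Z s)) A = emeasure (density lborel (\<lambda>z. ennreal (f z / c))) A" .
  qed simp
  then have "distributed (uniform_measure M B) lborel (Z s) (\<lambda>z. ennreal (f z / c))"
    by (simp add: distributed_def)
  with cond show ?thesis
    by (simp add: c_def f_def \<rho>_def B_def)
qed

end
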